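(* (i) Let $S\equiv\pm\{1, 3, 4, 5, 7, 16, 18, 19, 21, 22, 23, 25\}\pmod{52}$ and $T\equiv\pm\{1, 2, 3, 7, 11, 15, 18, 19, 20, 23, 24, 25\}\pmod{52}$. Then $p(S,n)=p(T,n-1)$ for all $n\geq 1$. (ii) Let $S\equiv\pm\{2, 3, 4, 5, 9, 11, 12, 14, 15, 17, 21, 23\}\pmod{52}$ and $T\equiv\pm\{2, 3, 5, 6, 7, 8, 9, 17, 19, 20, 21, 23\}\pmod{52}$. Then $p(S,n)=p(T,n)$ for all integers $n\ge0$ with $n\neq 4$. (iii) Let $S\equiv\pm\{3, 4, 5, 9, 10, 11, 14, 15, 16, 17, 21, 23\}\pmod{52}$ and $T\equiv\pm\{1, 5, 6, 9, 11, 14, 15, 17, 20, 21, 24, 25\}\pmod{52}$. Then $p(S,n)=p(T,n-3)$ for all $n\geq 3$. (iv) Let $S\equiv\pm\{2, 3, 5, 7, 8, 9, 17, 19, 21, 22, 23, 24\}\pmod{52}$ and $T\equiv\pm\{1, 3, 5, 7, 12, 14, 16, 19, 21, 22, 23, 25\}\pmod{52}$. Then $p(S,n)=p(T,n-2)$ for all $n\geq 2$. (v) Let $S\equiv\pm\{1, 6, 7, 9, 10, 11, 12, 15, 16, 17, 19, 25\}\pmod{52}$ and $T\equiv\pm\{1, 5, 6, 8, 9, 11, 15, 17, 18, 21, 24, 25\}\pmod{52}$. Then $p(S,n)=p(T,n-1)$ for all $n\geq 1$. (vi) Let $S\equiv\pm\{1, 4, 7, 9, 10, 11, 12, 15, 17,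 19, 22, 25\}\pmod{52}$ and $T\equiv\pm\{1, 3, 7, 8, 10, 11, 15, 18, 19, 20, 23, 25\}\pmod{52}$. Then $p(S,n)=p(T,n-1)$ for all $n\geq 1$.
   Context: For a set $S$ of positive integers and an integer $n\ge 0$, $p(S,n)$ denotes the number of partitions of $n$ into parts belonging to $S$ (so $p(S,0)=1$). The notation $S\equiv\pm\{r_1,\dots,r_k\}\pmod M$ means that $S$ is the set of all positive integers $n$ such that $n\equiv r_i$ or $n\equiv -r_i\pmod M$ for some $i$. *)

theory Defs
  imports "HOL-Library.Multiset" "HOL-Number_Theory.Cong"
begin

(* A partition of n is the multiset of its parts.  S is meant to be a set of
   positive integers; then there are only finitely many such multisets, so card
   is the true count.  (If 0 is in S, the set is infinite or empty and card is 0.) *)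
definition num_partitions :: "nat set \<Rightarrow> nat \<Rightarrow> nat" where
  "num_partitions S n = card {P :: nat multiset. set_mset P \<subseteq> S \<and> sum_mset P = n}"

definition pm_residues :: "int set \<Rightarrow> int \<Rightarrow> nat set" where
  "pm_residues R M =
     {n. n > 0 \<and> (\<exists>r\<in>R. [int n = r] (mod M) \<or> [int n = - r] (mod M))}"

end

theory Submission
  imports Defs "HOL-Complex_Analysis.Complex_Analysis"
begin

text \<open>
  In terms of generating functions part (i) says \<open>F(S) - q F(T) = 1\<close>. With \<open>q = exp (2 \<pi> i t / 52)\<close>
  both products are products of twelve Siegel functions at multiples of the torsion point \<open>t / 52\<close>.
  Replacing this point by \<open>(a t + b) / 52\<close> for all primitive pairs \<open>(a, b)\<close> modulo 52 gives a finite
  family of holomorphic functions \<open>defect a b\<close> on the upper half plane which \<open>SL(2,Z)\<close> permutes.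
  Their product is a modular function of level one. A lower bound for the orders of all the factors
  at infinity, together with the vanishing of the first 53 coefficients of part (i), shows that the
  product vanishes at infinity; by the maximum principle it is zero. Hence some factor is zero,
  and as \<open>SL(2,Z)\<close> acts transitively on primitive pairs, all are. The six parts are the cases
  \<open>b = 0\<close> and \<open>a = 1, 3, 5, 7, 9, 11\<close>.
\<close>

section \<open>q-Pochhammer products\<close>

text \<open>The obstacle is the number of cusps at level 52: at some of them the two products have
  poles, so agreement of coefficients at one cusp decides nothing by itself. Multiplying all
  conjugates moves the question to level one, where there is a single cusp and only the total order
  matters; the estimate becomes a finite sum of explicit quadratic exponents, with neither a valence
  formula nor representatives of the cusps. Twelve residues per set make this exact: inversion
  multiplies every Siegel function by the same factor \<open>c\<close>, whose twelfth power is an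
  exponential that a prefactor absorbs. The residues have an even sum and a sum of squares divisible
  by 104, which makes the conjugates depend on \<open>(a, b)\<close> modulo 52 only. The constant 1
  in the identity is invariant, so the defect itself, and not only its two terms, is
  permuted.\<close>

definition ee :: "complex \<Rightarrow> complex" where
  "ee z = exp (2 * of_real pi * \<i> * z)"

lemma ee_0 [simp]: "ee 0 = 1"
  by (simp add: ee_def)

lemma ee_add: "ee (x + y) = ee x * ee y"
  by (simp add: ee_def exp_add ring_distribs)

lemma ee_diff: "ee (x - y) = ee x / ee y"
  by (simp add: ee_def exp_diff ring_distribs)

lemma ee_minus: "ee (- x) = inverse (ee x)"
  by (simp add: ee_def exp_minus)

lemma ee_nonzero [simp]: "ee x \<noteq> 0"
  by (simp add: ee_def)

lemma ee_power: "ee x ^ n = ee (of_nat n * x)"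
  by (simp add: ee_def exp_of_nat_mult [symmetric] mult_ac)

lemma ee_of_int [simp]: "ee (of_int n) = 1"
  using exp_integer_2pi [of "of_int n"] by (simp add: ee_def mult_ac)

lemma ee_1 [simp]: "ee 1 = 1"
  using ee_of_int [of 1] by simp

lemma ee_half: "ee (1/2) = -1"
  by (simp add: ee_def exp_pi_i mult_ac)

lemma ee_quarter: "ee (1/4) = \<i>"
proof -
  have "ee (1/4) = exp (\<i> * of_real (pi / 2))"
    by (simp add: ee_def mult_ac)
  also have "\<dots> = cis (pi/2)"
    by (simp add: cis_conv_exp)
  finally show ?thesis
    by (simp add: cis_pi_half)
qed

lemma ee_eq_1_iff: "ee z = 1 \<longleftrightarrow> (\<exists>n::int. z = of_int n)"
proof
  assume "ee z = 1"
  then obtain n :: int where "Re (2 * of_real pi * \<i> * z) = 0" "Im (2 * of_real pi * \<i> * z) = of_int (2 * n) * pi"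
    unfolding ee_def exp_eq_1 by auto
  then have "Im z = 0" "Re z = of_int n"
    by (auto simp: field_simps)
  then show "\<exists>n::int. z = of_int n"
    by (intro exI [of _ n]) (simp add: complex_eq_iff)
qed auto

lemma norm_ee: "norm (ee z) = exp (- (2 * pi * Im z))"
  by (simp add: ee_def)

lemma norm_ee_less_1: "Im z > 0 \<Longrightarrow> norm (ee z) < 1"
  by (simp add: norm_ee)

lemma holomorphic_on_ee [holomorphic_intros]:
  "f holomorphic_on A \<Longrightarrow> (\<lambda>z. ee (f z)) holomorphic_on A"
  unfolding ee_def by (intro holomorphic_intros)

definition qpoch :: "complex \<Rightarrow> complex \<Rightarrow> complex" where
  "qpoch x q = (\<Prod>n. 1 - x * q ^ n)"

context
  fixes x q :: complex
  assumes q: "norm q < 1"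
begin

lemma abs_convergent_qpoch: "abs_convergent_prod (\<lambda>n. 1 - x * q ^ n)"
proof -
  have "summable (\<lambda>n. norm x * norm q ^ n)"
    using q by (intro summable_mult summable_geometric) auto
  then show ?thesis
    by (intro summable_imp_abs_convergent_prod) (simp add: norm_mult norm_power)
qed

lemma convergent_qpoch: "convergent_prod (\<lambda>n. 1 - x * q ^ n)"
  using abs_convergent_qpoch by (rule abs_convergent_prod_imp_convergent_prod)

lemma qpoch_LIMSEQ: "(\<lambda>N. \<Prod>n<N. 1 - x * q ^ n) \<longlonglongrightarrow> qpoch x q"
proof -
  have "(\<lambda>n. 1 - x * q ^ n) has_prod qpoch x q"
    unfolding qpoch_def using convergent_qpoch by (rule convergent_prod_has_prod)
  then show ?thesis
    by (rule has_prod_imp_tendsto')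
qed

lemma qpoch_eq_0_iff: "qpoch x q = 0 \<longleftrightarrow> (\<exists>n. x * q ^ n = 1)"
proof -
  have "(\<lambda>n. 1 - x * q ^ n) has_prod qpoch x q"
    unfolding qpoch_def using convergent_qpoch by (rule convergent_prod_has_prod)
  then have "qpoch x q = 0 \<longleftrightarrow> 0 \<in> range (\<lambda>n. 1 - x * q ^ n)"
    by (rule has_prod_eq_0_iff)
  also have "\<dots> \<longleftrightarrow> (\<exists>n. 1 - x * q ^ n = 0)"
    by (simp only: image_iff bex_UNIV eq_commute [of 0])
  also have "\<dots> \<longleftrightarrow> (\<exists>n. x * q ^ n = 1)"
    by (simp only: right_minus_eq eq_commute [of 1])
  finally show ?thesis .
qed

end

lemma qpoch_rec:
  assumes "norm q < 1"
  shows "qpoch x q = (1 - x) * qpoch (x * q) q"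
proof (rule LIMSEQ_unique)
  show "(\<lambda>N. \<Prod>n<Suc N. 1 - x * q ^ n) \<longlonglongrightarrow> qpoch x q"
    using qpoch_LIMSEQ [OF assms] LIMSEQ_Suc by blast
  have "(\<lambda>N. (1 - x) * (\<Prod>n<N. 1 - (x * q) * q ^ n)) \<longlonglongrightarrow> (1 - x) * qpoch (x * q) q"
    by (intro tendsto_mult tendsto_const qpoch_LIMSEQ assms)
  then show "(\<lambda>N. \<Prod>n<Suc N. 1 - x * q ^ n) \<longlonglongrightarrow> (1 - x) * qpoch (x * q) q"
    by (subst prod.lessThan_Suc_shift) (simp add: mult_ac)
qed

text \<open>Only the first factor can come close to 0, so it is kept; after it the terms
  \<open>x * q ^ n\<close> have modulus at most \<open>(1/4) ^ n\<close>, and the inequality of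
  Weierstrass bounds the rest of the product below by 1 minus their sum. Lower bounds are wanted
  because the partition series are reciprocals of such products.\<close>

lemma qpoch_lower_bound:
  assumes q: "norm q \<le> 1/4" and x: "norm x \<le> 1"
  shows "norm (qpoch x q) \<ge> norm (1 - x) / 2"
proof -
  have lt: "norm q < 1"
    using q by simp
  have part: "norm (\<Prod>n<N. 1 - (x * q) * q ^ n) \<ge> 1/2" for N
  proof -
    have le: "norm (x * q * q ^ n) \<le> (1/4) ^ Suc n" for n
    proof -
      have "norm (x * q * q ^ n) = norm x * norm q ^ Suc n"
        by (simp add: norm_mult norm_power)
      also have "\<dots> \<le> 1 * (1/4) ^ Suc n"
        using assms by (intro mult_mono power_mono) auto
      finally show ?thesis by simp
    qed
    have "(\<Sum>n<N. norm (x * q * q ^ n)) \<le> (\<Sum>n<N. (1/4) ^ Suc n :: real)"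
      by (intro sum_mono le)
    also have "\<dots> = (1/4) * (\<Sum>n<N. (1/4) ^ n)"
      by (simp add: sum_distrib_left)
    also have "\<dots> \<le> (1/4) * 2"
      by (subst sum_gp_strict) (auto simp: field_simps)
    finally have sum: "(\<Sum>n<N. norm (x * q * q ^ n)) \<le> 1/2"
      by simp
    have "1/2 \<le> 1 - (\<Sum>n<N. norm (x * q * q ^ n))"
      using sum by simp
    also have "\<dots> \<le> (\<Prod>n<N. 1 - norm (x * q * q ^ n))"
    proof (rule Weierstrass_prod_ineq)
      fix n
      have "(1/4) ^ Suc n \<le> (1::real)"
        by (rule power_le_one) auto
      then show "norm (x * q * q ^ n) \<in> {0..1}"
        using le [of n] by auto
    qed
    also have "\<dots> \<le> (\<Prod>n<N. norm (1 - x * q * q ^ n))"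
    proof (rule prod_mono)
      fix n
      have "(1/4) ^ Suc n \<le> (1::real)"
        by (rule power_le_one) auto
      then have "norm (x * q * q ^ n) \<le> 1"
        using le [of n] by linarith
      moreover have "norm (1::complex) - norm (x * q * q ^ n) \<le> norm (1 - x * q * q ^ n)"
        by (rule norm_triangle_ineq2)
      ultimately show "0 \<le> 1 - norm (x * q * q ^ n) \<and> 1 - norm (x * q * q ^ n) \<le> norm (1 - x * q * q ^ n)"
        by simp
    qed
    finally show ?thesis
      by (simp add: prod_norm)
  qed
  have "norm (qpoch (x * q) q) \<ge> 1/2"
    by (rule tendsto_lowerbound [OF tendsto_norm [OF qpoch_LIMSEQ [OF lt, of "x * q"]]])
      (use part in auto)
  then have "norm (1 - x) * (1/2) \<le> norm (1 - x) * norm (qpoch (x * q) q)"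
    by (intro mult_left_mono) auto
  then show ?thesis
    by (simp add: qpoch_rec [OF lt, of x] norm_mult)
qed

lemma holomorphic_on_qpoch [holomorphic_intros]:
  assumes f: "f holomorphic_on A" and g: "g holomorphic_on A" and A: "open A"
    and lt: "\<And>z. z \<in> A \<Longrightarrow> norm (g z) < 1"
  shows "(\<lambda>z. qpoch (f z) (g z)) holomorphic_on A"
proof (rule holomorphic_uniform_sequence [OF A])
  show "(\<lambda>z. \<Prod>n<N. 1 - f z * g z ^ n) holomorphic_on A" for N
    by (intro holomorphic_intros f g)
next
  fix z assume z: "z \<in> A"
  then obtain d where d: "d > 0" "cball z d \<subseteq> A"
    using A open_contains_cball by blast
  have cf: "continuous_on (cball z d) f" and cg: "continuous_on (cball z d) g"
    using f g d holomorphic_on_imp_continuous_on continuous_on_subset by blast+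
  obtain w where w: "w \<in> cball z d" "\<And>y. y \<in> cball z d \<Longrightarrow> norm (g y) \<le> norm (g w)"
    using continuous_attains_sup [OF compact_cball _ continuous_on_norm [OF cg]] d
    by (metis centre_in_cball empty_iff less_imp_le)
  obtain w' where w': "w' \<in> cball z d" "\<And>y. y \<in> cball z d \<Longrightarrow> norm (f y) \<le> norm (f w')"
    using continuous_attains_sup [OF compact_cball _ continuous_on_norm [OF cf]] d
    by (metis centre_in_cball empty_iff less_imp_le)
  define r where "r = norm (g w)"
  have r: "0 \<le> r" "r < 1"
    using w d lt by (auto simp: r_def)
  have "uniformly_convergent_on (cball z d) (\<lambda>N y. \<Prod>n<N. 1 - f y * g y ^ n)"
  proof (rule uniformly_convergent_on_prod')
    show "uniformly_convergent_on (cball z d) (\<lambda>N y. \<Sum>n<N. norm (1 - f y * g y ^ n - 1))"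
    proof (rule Weierstrass_m_test')
      show "norm (norm (1 - f y * g y ^ n - 1)) \<le> norm (f w') * r ^ n" if "y \<in> cball z d" for n y
        using w(2) [OF that] w'(2) [OF that]
        by (auto simp: norm_mult norm_power r_def intro!: mult_mono power_mono)
      show "summable (\<lambda>n. norm (f w') * r ^ n)"
        using r by (intro summable_mult summable_geometric) auto
    qed
  qed (use cf cg in \<open>auto intro!: continuous_intros\<close>)
  then obtain l where l: "uniform_limit (cball z d) (\<lambda>N y. \<Prod>n<N. 1 - f y * g y ^ n) l sequentially"
    by (auto simp: uniformly_convergent_on_def)
  have "l y = qpoch (f y) (g y)" if "y \<in> cball z d" for y
  proof (rule LIMSEQ_unique)
    show "(\<lambda>N. \<Prod>n<N. 1 - f y * g y ^ n) \<longlonglongrightarrow> l y"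
      using l that by (rule tendsto_uniform_limitI)
    show "(\<lambda>N. \<Prod>n<N. 1 - f y * g y ^ n) \<longlonglongrightarrow> qpoch (f y) (g y)"
      using lt d that by (intro qpoch_LIMSEQ) auto
  qed
  then have "uniform_limit (cball z d) (\<lambda>N y. \<Prod>n<N. 1 - f y * g y ^ n)
      (\<lambda>y. qpoch (f y) (g y)) sequentially"
    using l by (subst uniform_limit_cong' [where g = "\<lambda>N y. \<Prod>n<N. 1 - f y * g y ^ n" and i = l]) auto
  then show "\<exists>d>0. cball z d \<subseteq> A \<and> uniform_limit (cball z d)
      (\<lambda>N y. \<Prod>n<N. 1 - f y * g y ^ n) (\<lambda>y. qpoch (f y) (g y)) sequentially"
    using d by blast
qed

section \<open>The theta function and its inversion\<close>

text \<open>Jacobi's theta_1 divided by eta, without the factor q^(1/12) and up to a constant.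
  Dropping the product of the \<open>1 - q ^ n\<close> leaves weight 0 and exactly the products that
  occur in partition series; \<open>ee (- z / 2)\<close> makes the function odd.\<close>

definition theta :: "complex \<Rightarrow> complex \<Rightarrow> complex" where
  "theta z t = ee (- z / 2) * (qpoch (ee z) (ee t) * qpoch (ee (t - z)) (ee t))"

context
  fixes t :: complex
  assumes t: "Im t > 0"
begin

text \<open>With the factor that vanishes at \<open>z = 0\<close> split off, the remaining
  q-products are even in \<open>z\<close>. Oddness, the quasi-period \<open>t\<close> and the
  derivative at 0 are read off from this form.\<close>

lemma theta_factor:
  "theta z t = ee (- z / 2) * (1 - ee z) * (qpoch (ee (t + z)) (ee t) * qpoch (ee (t - z)) (ee t))"
  using qpoch_rec [OF norm_ee_less_1 [OF t], of "ee z"]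
  by (simp add: theta_def ee_add mult_ac)

lemma theta_minus: "theta (- z) t = - theta z t"
proof -
  have "ee (- z / 2) * ee (- z / 2) = ee (- z)"
    by (simp add: ee_add [symmetric])
  then have eq: "ee (z / 2) * (1 - ee (- z)) = - (ee (- z / 2) * (1 - ee z))"
    by (simp add: ee_minus field_simps)
  have "theta (- z) t = ee (z / 2) * (1 - ee (- z)) * (qpoch (ee (t + z)) (ee t) * qpoch (ee (t - z)) (ee t))"
    by (simp add: theta_factor [of "- z"] mult_ac)
  then show ?thesis
    by (simp only: eq theta_factor [of z] mult_minus_left)
qed

lemma theta_add_1: "theta (z + 1) t = - theta z t"
proof -
  have "ee (- (z + 1) / 2) = ee (- z / 2) / ee (1/2)"
    by (simp add: ee_diff [symmetric] add_divide_distrib diff_divide_distrib)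
  moreover have "ee (t - (z + 1)) = ee (t - z)"
    by (simp add: ee_diff ee_add)
  ultimately show ?thesis
    by (simp add: theta_def ee_half ee_add)
qed

lemma theta_add_t: "theta (z + t) t = - ee (- z - t / 2) * theta z t"
proof -
  have 1: "theta (z + t) t = ee (- (z + t) / 2) * (qpoch (ee (t + z)) (ee t) * qpoch (ee (- z)) (ee t))"
    by (simp add: theta_def add.commute)
  have 2: "qpoch (ee (- z)) (ee t) = (1 - ee (- z)) * qpoch (ee (t - z)) (ee t)"
    using qpoch_rec [OF norm_ee_less_1 [OF t], of "ee (- z)"]
    by (simp add: ee_add [symmetric])
  have 3: "ee (- (z + t) / 2) * (1 - ee (- z)) = - ee (- z - t / 2) * (ee (- z / 2) * (1 - ee z))"
  proof -
    have "ee (- (z + t) / 2) = ee (- z / 2) * ee (- t / 2)"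
      by (simp add: ee_add [symmetric] add_divide_distrib diff_divide_distrib)
    moreover have "ee (- z - t / 2) = ee (- z) * ee (- t / 2)"
      by (simp add: ee_add [symmetric])
    moreover have "A * B * (1 - inverse Z) = - (inverse Z * B) * (A * (1 - Z))"
      if "Z \<noteq> 0" for A B Z :: complex
      using that by (simp add: field_simps)
    ultimately show ?thesis
      by (simp only: ee_minus [of z] ee_nonzero not_False_eq_True)
  qed
  have "theta (z + t) t = ee (- (z + t) / 2) * (1 - ee (- z)) *
      (qpoch (ee (t + z)) (ee t) * qpoch (ee (t - z)) (ee t))"
    by (simp only: 1 2 mult_ac)
  then show ?thesis
    unfolding 3 theta_factor [of z] by (simp only: mult.assoc)
qed

lemma theta_eq_0_iff: "theta z t = 0 \<longleftrightarrow> (\<exists>m n :: int. z = of_int m + of_int n * t)"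
proof
  assume "theta z t = 0"
  then consider n where "ee z * ee t ^ n = 1" | n where "ee (t - z) * ee t ^ n = 1"
    by (auto simp: theta_def qpoch_eq_0_iff norm_ee_less_1 [OF t])
  then show "\<exists>m n :: int. z = of_int m + of_int n * t"
  proof cases
    case (1 n)
    then have "ee (z + of_nat n * t) = 1"
      by (simp add: ee_power ee_add)
    then obtain m :: int where "z + of_nat n * t = of_int m"
      using ee_eq_1_iff by auto
    then show ?thesis
      by (intro exI [of _ m] exI [of _ "- int n"]) (simp add: algebra_simps)
  next
    case (2 n)
    then have "ee (t - z + of_nat n * t) = 1"
      by (simp add: ee_power ee_add)
    then obtain m :: int where "t - z + of_nat n * t = of_int m"
      using ee_eq_1_iff by auto
    then show ?thesis
      by (intro exI [of _ "- m"] exI [of _ "int n + 1"]) (simp add: algebra_simps)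
  qed
next
  assume "\<exists>m n :: int. z = of_int m + of_int n * t"
  then obtain m n :: int where z: "z = of_int m + of_int n * t"
    by blast
  show "theta z t = 0"
  \<comment> \<open>The first q-product vanishes at the lattice points with
    \<open>n \<le> 0\<close>, the second at those with \<open>n > 0\<close>.\<close>
  proof (cases "n \<le> 0")
    case True
    then have "ee z * ee t ^ nat (- n) = 1"
      by (simp add: z ee_power ee_add [symmetric] of_nat_nat)
    then show ?thesis
      by (auto simp: theta_def qpoch_eq_0_iff norm_ee_less_1 [OF t])
  next
    case False
    then have "ee (t - z) * ee t ^ nat (n - 1) = ee (of_int (- m))"
      by (simp add: z ee_power ee_add [symmetric] of_nat_nat algebra_simps)
    then have "ee (t - z) * ee t ^ nat (n - 1) = 1"
      by (simp only: ee_of_int)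
    then show ?thesis
      by (auto simp: theta_def qpoch_eq_0_iff norm_ee_less_1 [OF t])
  qed
qed

lemma holomorphic_theta_left: "(\<lambda>z. theta z t) holomorphic_on A"
proof (rule holomorphic_on_subset)
  show "(\<lambda>z. theta z t) holomorphic_on UNIV"
    unfolding theta_def using norm_ee_less_1 [OF t] by (intro holomorphic_intros) auto
qed auto

text \<open>The zero at 0 is simple, hence by quasi-periodicity so is every lattice zero, and
  dividing by theta a function that also vanishes there creates only removable
  singularities.\<close>

lemma deriv_theta_0_nonzero: "deriv (\<lambda>z. theta z t) 0 \<noteq> 0"
proof -
  define g where "g z = qpoch (ee (t + z)) (ee t) * qpoch (ee (t - z)) (ee t)" for z
  have hol: "g holomorphic_on UNIV"
    unfolding g_def using norm_ee_less_1 [OF t] by (intro holomorphic_intros) auto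
  have "g 0 \<noteq> 0"
  proof
    assume "g 0 = 0"
    then obtain n where n: "ee t * ee t ^ n = 1"
      by (auto simp: g_def qpoch_eq_0_iff norm_ee_less_1 [OF t])
    have "norm (ee t * ee t ^ n) = norm (ee t) ^ Suc n"
      by (simp add: norm_mult norm_power)
    also have "\<dots> < 1"
      by (rule power_Suc_less_one) (use norm_ee_less_1 [OF t] in auto)
    finally show False
      using n by simp
  qed
  have g': "(g has_field_derivative deriv g 0) (at 0)"
    using hol by (simp add: holomorphic_derivI)
  have "((\<lambda>z. ee (- z / 2) * (1 - ee z) * g z) has_field_derivative - (2 * of_real pi * \<i>) * g 0) (at 0)"
    unfolding ee_def by (auto intro!: derivative_eq_intros g')
  also have "(\<lambda>z. ee (- z / 2) * (1 - ee z) * g z) = (\<lambda>z. theta z t)"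
    by (simp add: theta_factor g_def)
  finally have "deriv (\<lambda>z. theta z t) 0 = - (2 * of_real pi * \<i>) * g 0"
    by (rule DERIV_imp_deriv)
  with \<open>g 0 \<noteq> 0\<close> show ?thesis
    by simp
qed

end

text \<open>The quotient of two functions with these quasi-periods and zeros is entire and elliptic,
  hence constant by Liouville's theorem.\<close>

lemma theta_unique:
  assumes t: "Im t > 0"
    and hol: "f holomorphic_on UNIV" and f0: "f 0 = 0"
    and f1: "\<And>z. f (z + 1) = - f z"
    and ft: "\<And>z. f (z + t) = - ee (- z - t / 2) * f z"
  shows "\<exists>c. \<forall>z. f z = c * theta z t"
proof -
  define L where "L = {z. theta z t = 0}"
  define d where "d = deriv f 0 / deriv (\<lambda>z. theta z t) 0"
  \<comment> \<open>The value \<open>d\<close> is the limit of the quotient at 0; one value serves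
    every lattice point because \<open>f\<close> and theta have the same multipliers under both
    translations.\<close>
  define g where "g z = (if z \<in> L then d else f z / theta z t)" for z
  have L1: "z + 1 \<in> L \<longleftrightarrow> z \<in> L" for z
    by (simp add: L_def theta_add_1 [OF t])
  have Lt: "z + t \<in> L \<longleftrightarrow> z \<in> L" for z
    by (simp add: L_def theta_add_t [OF t])
  have g1: "g (z + 1) = g z" for z
    by (simp add: g_def L1 f1 theta_add_1 [OF t])
  have gt: "g (z + t) = g z" for z
    by (simp add: g_def Lt ft theta_add_t [OF t])
  have g1n: "g (z + of_nat n) = g z" for z n
    by (induction n) (simp_all add: g1 add.assoc [symmetric] add.commute [of 1])
  have gtn: "g (z + of_nat n * t) = g z" for z n
  proof (induction n)
    case (Suc n)
    have "g (z + of_nat (Suc n) * t) = g (z + of_nat n * t + t)"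
      by (simp add: algebra_simps)
    then show ?case
      using Suc gt by simp
  qed simp
  have g1i: "g (z + of_int n) = g z" for z n
  proof (cases "n \<ge> 0")
    case True
    then show ?thesis using g1n [of z "nat n"] by simp
  next
    case False
    then show ?thesis using g1n [of "z + of_int n" "nat (- n)"] by simp
  qed
  have gti: "g (z + of_int n * t) = g z" for z n
  proof (cases "n \<ge> 0")
    case True
    then show ?thesis using gtn [of z "nat n"] by simp
  next
    case False
    then show ?thesis using gtn [of "z + of_int n * t" "nat (- n)"] by simp
  qed
  have period: "g (z + (of_int m + of_int n * t)) = g z" for z m n
    using gti [of "z + of_int m" n] g1i [of z m] by (simp add: add.assoc)

  obtain r where r: "r > 0" "\<And>z. z \<in> ball 0 r \<Longrightarrow> z \<in> L \<Longrightarrow> z = 0"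
  proof -
    define r where "r = min 1 (Im t)"
    have "z = 0" if z: "z \<in> ball 0 r" "z \<in> L" for z
    proof -
      obtain m n :: int where mn: "z = of_int m + of_int n * t"
        using z(2) theta_eq_0_iff [OF t] by (auto simp: L_def)
      have nz: "norm z < 1" "norm z < Im t"
        using z(1) by (auto simp: r_def)
      have "\<bar>Im z\<bar> < Im t"
        using abs_Im_le_cmod [of z] nz by linarith
      then have "\<bar>of_int n\<bar> * Im t < 1 * Im t"
        using t by (simp add: mn abs_mult)
      then have "\<bar>of_int n :: real\<bar> < 1"
        using t by (simp only: mult_less_cancel_right_pos)
      then have n: "n = 0"
        by linarith
      have "\<bar>Re z\<bar> < 1"
        using abs_Re_le_cmod [of z] nz by linarith
      then have "m = 0"
        by (simp add: mn n)
      then show "z = 0"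
        by (simp add: mn n)
    qed
    then show ?thesis
      using that [of r] t by (simp add: r_def)
  qed
  have theta0: "theta 0 t = 0"
    using theta_eq_0_iff [OF t] by (metis add_0 mult_zero_left of_int_0)
  then have L0: "0 \<in> L"
    by (simp add: L_def)
  have lim: "(g \<longlongrightarrow> g 0) (at 0)"
  proof -
    have "(f has_field_derivative deriv f 0) (at 0)"
      using hol by (simp add: holomorphic_derivI)
    then have "((\<lambda>z. f z / z) \<longlongrightarrow> deriv f 0) (at 0)"
      by (simp add: has_field_derivative_iff f0)
    moreover have "((\<lambda>z. theta z t) has_field_derivative deriv (\<lambda>z. theta z t) 0) (at 0)"
      using holomorphic_theta_left [OF t, of UNIV] by (simp add: holomorphic_derivI)
    then have "((\<lambda>z. theta z t / z) \<longlongrightarrow> deriv (\<lambda>z. theta z t) 0) (at 0)"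
      by (simp add: has_field_derivative_iff theta0)
    ultimately have "((\<lambda>z. (f z / z) / (theta z t / z)) \<longlongrightarrow> d) (at 0)"
      unfolding d_def by (intro tendsto_divide deriv_theta_0_nonzero t)
    moreover have "eventually (\<lambda>z. (f z / z) / (theta z t / z) = g z) (at 0)"
    proof -
      have "eventually (\<lambda>z. z \<in> ball 0 r - {0}) (at 0)"
        using r(1) by (intro eventually_at_in_open) auto
      then show ?thesis
        by eventually_elim (use r(2) in \<open>auto simp: g_def\<close>)
    qed
    ultimately have "(g \<longlongrightarrow> d) (at 0)"
      by (rule Lim_transform_eventually)
    then show ?thesis
      using L0 by (simp add: g_def)
  qed
  have hol0: "g holomorphic_on ball 0 r"
  proof (rule no_isolated_singularity' [where K = "{0}"])
    show "(g \<longlongrightarrow> g z) (at z within ball 0 r)" if "z \<in> {0}" for z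
      using that lim by (auto intro: tendsto_within_subset)
    have "(\<lambda>z. f z / theta z t) holomorphic_on ball 0 r - {0}"
      using r(2) by (intro holomorphic_intros holomorphic_on_subset [OF hol] holomorphic_theta_left t)
        (auto simp: L_def)
    then show "g holomorphic_on ball 0 r - {0}"
      by (rule holomorphic_transform) (use r(2) in \<open>auto simp: g_def\<close>)
  qed auto
  have closedL: "closed L"
    unfolding L_def
    using holomorphic_on_imp_continuous_on [OF holomorphic_theta_left [OF t, of UNIV]]
    by (intro closed_Collect_eq) auto
  have "g field_differentiable at z" for z
  proof (cases "z \<in> L")
    case True
    then obtain m n :: int where mn: "z = of_int m + of_int n * t"
      using theta_eq_0_iff [OF t] by (auto simp: L_def)
    have "g field_differentiable at 0"
      using hol0 r(1) by (auto simp: holomorphic_on_open field_differentiable_def)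
    then obtain D where "(g has_field_derivative D) (at (z - z))"
      by (auto simp: field_differentiable_def)
    then have "((\<lambda>w. g (w - z)) has_field_derivative D) (at z)"
      using DERIV_shift [of g D z "- z"] by simp
    moreover have "g (w - z) = g w" for w
      using period [of "w - z" m n] by (simp add: mn)
    ultimately show ?thesis
      by (auto simp: field_differentiable_def)
  next
    case False
    have "(\<lambda>z. f z / theta z t) holomorphic_on - L"
      by (intro holomorphic_intros holomorphic_on_subset [OF hol] holomorphic_theta_left t)
        (auto simp: L_def)
    then have "g holomorphic_on - L"
      by (rule holomorphic_transform) (auto simp: g_def)
    then show ?thesis
      using False closedL by (intro holomorphic_on_imp_differentiable_at) auto
  qed
  then have holg: "g holomorphic_on UNIV"
    by (auto simp: holomorphic_on_def field_differentiable_at_within)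
  define K where "K = (\<lambda>(x, y). of_real x + of_real y * t) ` ({0..1} \<times> {0..1::real})"
  have "compact K"
    unfolding K_def
    by (intro compact_continuous_image compact_Times compact_Icc)
      (auto simp: case_prod_unfold intro!: continuous_intros)
  moreover have "continuous_on K g"
    using holg holomorphic_on_imp_continuous_on continuous_on_subset by blast
  ultimately have "bounded (g ` K)"
    by (intro compact_imp_bounded compact_continuous_image)
  moreover have "range g \<subseteq> g ` K"
  proof
    fix y assume "y \<in> range g"
    then obtain z where y: "y = g z"
      by auto
    define b where "b = Im z / Im t"
    define a where "a = Re z - b * Re t"
    have z: "z = of_real a + of_real b * t"
      using t by (simp add: complex_eq_iff a_def b_def)
    define w where "w = of_real (frac a) + of_real (frac b) * t"
    have "w \<in> K"
      unfolding K_def w_def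
      by (intro image_eqI [where x = "(frac a, frac b)"]) (auto simp: less_imp_le frac_lt_1)
    moreover have "z = w + (of_int \<lfloor>a\<rfloor> + of_int \<lfloor>b\<rfloor> * t)"
      by (simp add: z w_def frac_def algebra_simps)
    ultimately show "y \<in> g ` K"
      using y period by auto
  qed
  ultimately have "bounded (range g)"
    using bounded_subset by blast
  then obtain c where c: "\<And>z. g z = c"
    using Liouville_theorem [OF holg] by (auto simp: constant_on_def)
  \<comment> \<open>On \<open>L\<close> the value of \<open>g\<close> was prescribed, so
    \<open>g = c\<close> says nothing about \<open>f\<close> there; its zeros at the lattice points
    come from \<open>f 0 = 0\<close> and the quasi-periods.\<close>
  have fL: "f z = 0" if zL: "z \<in> L" for z
  proof -
    have fn1: "f (z + of_int m) = 0 \<longleftrightarrow> f z = 0" for z m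
    proof (induction m rule: int_induct [where k = 0])
      case (step1 i)
      then show ?case using f1 [of "z + of_int i"] by (simp add: add.assoc)
    next
      case (step2 i)
      then show ?case using f1 [of "z + of_int (i - 1)"] by (simp add: add.assoc)
    qed simp
    have fnt: "f (z + of_int m * t) = 0 \<longleftrightarrow> f z = 0" for z m
    proof (induction m rule: int_induct [where k = 0])
      case (step1 i)
      then show ?case using ft [of "z + of_int i * t"] by (simp add: algebra_simps)
    next
      case (step2 i)
      then show ?case using ft [of "z + of_int (i - 1) * t"] by (simp add: algebra_simps)
    qed simp
    obtain m n :: int where mn: "z = of_int m + of_int n * t"
      using zL theta_eq_0_iff [OF t] by (auto simp: L_def)
    show ?thesis
      using fnt [of "of_int m" n] fn1 [of 0 m] f0 by (simp add: mn)
  qed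
  have "f z = c * theta z t" for z
  proof (cases "z \<in> L")
    case True
    then show ?thesis by (simp add: fL) (simp add: L_def)
  next
    case False
    then show ?thesis using c [of z] by (auto simp: g_def L_def field_simps)
  qed
  then show ?thesis
    by blast
qed

section \<open>Euler's product and the theta values at the half periods\<close>

lemma qpoch_mult_minus:
  assumes "norm q < 1"
  shows "qpoch x q * qpoch (- x) q = qpoch (x\<^sup>2) (q\<^sup>2)"
proof (rule LIMSEQ_unique)
  have q2: "norm (q\<^sup>2) < 1"
    using assms by (simp add: norm_power power_less_one_iff abs_square_less_1)
  show "(\<lambda>N. \<Prod>n<N. 1 - x\<^sup>2 * (q\<^sup>2) ^ n) \<longlonglongrightarrow> qpoch (x\<^sup>2) (q\<^sup>2)"
    using q2 by (rule qpoch_LIMSEQ)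
  have "(\<lambda>N. (\<Prod>n<N. 1 - x * q ^ n) * (\<Prod>n<N. 1 - (- x) * q ^ n)) \<longlonglongrightarrow> qpoch x q * qpoch (- x) q"
    by (intro tendsto_mult qpoch_LIMSEQ assms)
  also have "(\<lambda>N. (\<Prod>n<N. 1 - x * q ^ n) * (\<Prod>n<N. 1 - (- x) * q ^ n)) =
      (\<lambda>N. \<Prod>n<N. 1 - x\<^sup>2 * (q\<^sup>2) ^ n)"
    by (simp add: prod.distrib [symmetric] algebra_simps power2_eq_square power_mult_distrib)
  finally show "(\<lambda>N. \<Prod>n<N. 1 - x\<^sup>2 * (q\<^sup>2) ^ n) \<longlonglongrightarrow> qpoch x q * qpoch (- x) q" .
qed

lemma qpoch_even_odd:
  assumes "norm q < 1"
  shows "qpoch x q = qpoch x (q\<^sup>2) * qpoch (x * q) (q\<^sup>2)"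
proof (rule LIMSEQ_unique)
  have q2: "norm (q\<^sup>2) < 1"
    using assms by (simp add: norm_power power_less_one_iff abs_square_less_1)
  have "filterlim (\<lambda>N::nat. 2 * N) at_top sequentially"
    by (rule mult_nat_left_at_top) auto
  then show "(\<lambda>N. \<Prod>n<2 * N. 1 - x * q ^ n) \<longlonglongrightarrow> qpoch x q"
    using qpoch_LIMSEQ [OF assms, of x] by (rule filterlim_compose [rotated])
  have "(\<lambda>N. (\<Prod>n<N. 1 - x * (q\<^sup>2) ^ n) * (\<Prod>n<N. 1 - x * q * (q\<^sup>2) ^ n)) \<longlonglongrightarrow>
      qpoch x (q\<^sup>2) * qpoch (x * q) (q\<^sup>2)"
    by (intro tendsto_mult qpoch_LIMSEQ q2)
  also have "(\<lambda>N. (\<Prod>n<N. 1 - x * (q\<^sup>2) ^ n) * (\<Prod>n<N. 1 - x * q * (q\<^sup>2) ^ n)) =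
      (\<lambda>N. \<Prod>n<2 * N. 1 - x * q ^ n)"
  proof
    show "(\<Prod>n<N. 1 - x * (q\<^sup>2) ^ n) * (\<Prod>n<N. 1 - x * q * (q\<^sup>2) ^ n) = (\<Prod>n<2 * N. 1 - x * q ^ n)" for N
      by (induction N) (simp_all add: power_mult [symmetric] mult_ac)
  qed
  finally show "(\<lambda>N. \<Prod>n<2 * N. 1 - x * q ^ n) \<longlonglongrightarrow> qpoch x (q\<^sup>2) * qpoch (x * q) (q\<^sup>2)" .
qed

text \<open>Euler: the odd-part and distinct-part products are inverse to each other.\<close>

lemma qpoch_half_periods:
  assumes p: "norm p < 1"
  shows "qpoch p (p\<^sup>2) * qpoch (- p) (p\<^sup>2) * qpoch (- (p\<^sup>2)) (p\<^sup>2) = 1"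
proof -
  define q where "q = p\<^sup>2"
  have q: "norm q < 1"
    using p by (simp add: q_def norm_power power_less_one_iff abs_square_less_1)
  have q2: "norm (q\<^sup>2) < 1"
    using q by (simp add: norm_power power_less_one_iff abs_square_less_1)
  have 1: "qpoch p q * qpoch (- p) q = qpoch q (q\<^sup>2)"
    using qpoch_mult_minus [OF q, of p] by (simp add: q_def)
  have 2: "qpoch q q * qpoch (- q) q = qpoch (q\<^sup>2) (q\<^sup>2)"
    using qpoch_mult_minus [OF q, of q] by simp
  have 3: "qpoch q q = qpoch q (q\<^sup>2) * qpoch (q\<^sup>2) (q\<^sup>2)"
    using qpoch_even_odd [OF q, of q] by (simp add: power2_eq_square)
  have nz: "qpoch (q\<^sup>2) (q\<^sup>2) \<noteq> 0"
  proof
    assume "qpoch (q\<^sup>2) (q\<^sup>2) = 0"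
    then obtain n where n: "q\<^sup>2 * (q\<^sup>2) ^ n = 1"
      using qpoch_eq_0_iff [OF q2] by blast
    have "norm (q\<^sup>2 * (q\<^sup>2) ^ n) = norm (q\<^sup>2) ^ Suc n"
      by (simp add: norm_mult norm_power)
    also have "\<dots> < 1"
      by (subst power_less_one_iff) (use q2 in auto)
    finally show False
      using n by simp
  qed
  have "qpoch q (q\<^sup>2) * qpoch (- q) q * qpoch (q\<^sup>2) (q\<^sup>2) = qpoch (q\<^sup>2) (q\<^sup>2)"
    using 2 3 by (simp add: mult_ac)
  then have "qpoch q (q\<^sup>2) * qpoch (- q) q = 1"
    using nz by simp
  then show ?thesis
    using 1 by (simp add: q_def)
qed

text \<open>The identity theta_2 theta_3 theta_4 = 2 eta^3 in this normalisation. Each half period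
  contributes the square of one of Euler's three products; these cancel to 1 and leave an
  exponential.\<close>

lemma theta_half_periods:
  assumes t: "Im t > 0"
  shows "theta (1/2) t * theta (t/2) t * theta ((1 + t)/2) t = - 2 * ee (- t / 2)"
proof -
  define p where "p = ee (t / 2)"
  have p2: "p\<^sup>2 = ee t"
    by (simp add: p_def ee_power)
  have p: "norm p < 1"
    unfolding p_def using t by (intro norm_ee_less_1) simp
  have q: "norm (ee t) < 1"
    using t by (rule norm_ee_less_1)
  have e: "ee (- 1 / 2) = -1"
    using ee_minus [of "1/2"] by (simp add: ee_half)
  have "ee (t - 1/2) = - ee t"
    by (simp add: ee_diff ee_half)
  moreover have "qpoch (- 1) (ee t) = 2 * qpoch (- ee t) (ee t)"
    using qpoch_rec [OF q, of "- 1"] by simp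
  ultimately have 1: "theta (1/2) t = 2 * ee (- 1/4) * (qpoch (- ee t) (ee t))\<^sup>2"
    by (simp add: theta_def ee_half power2_eq_square)
  have 2: "theta (t/2) t = ee (- t/4) * (qpoch p (ee t))\<^sup>2"
    by (simp add: theta_def p_def power2_eq_square)
  have "ee ((1 + t)/2) = - p" "ee (t - (1 + t)/2) = - p"
    using ee_add [of "1/2" "t/2"] ee_diff [of "t/2" "1/2"]
    by (simp_all add: p_def ee_half add_divide_distrib)
  then have 3: "theta ((1 + t)/2) t = ee (- 1/4 - t/4) * (qpoch (- p) (ee t))\<^sup>2"
    by (simp add: theta_def power2_eq_square add_divide_distrib diff_divide_distrib)
  have "ee (- 1/4) * ee (- t/4) * ee (- 1/4 - t/4) = ee (- 1/2 + - t / 2)"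
    by (simp add: ee_add [symmetric])
  also have "\<dots> = - ee (- t / 2)"
    by (simp only: ee_add e) simp
  finally have 4: "ee (- 1/4) * ee (- t/4) * ee (- 1/4 - t/4) = - ee (- t / 2)" .
  have "theta (1/2) t * theta (t/2) t * theta ((1 + t)/2) t =
      2 * (ee (- 1/4) * ee (- t/4) * ee (- 1/4 - t/4)) *
      (qpoch p (ee t) * qpoch (- p) (ee t) * qpoch (- ee t) (ee t))\<^sup>2"
    unfolding 1 2 3 by (simp add: power2_eq_square mult_ac)
  also have "qpoch p (ee t) * qpoch (- p) (ee t) * qpoch (- ee t) (ee t) = 1"
    using qpoch_half_periods [OF p] by (simp add: p2)
  finally show ?thesis
    unfolding 4 by simp
qed

lemma Im_minus_inverse_pos: "Im t > 0 \<Longrightarrow> Im (- 1 / t) > 0"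
  by (auto simp: Im_divide sum_power2_gt_zero_iff intro!: divide_pos_pos)

text \<open>Uniqueness gives the transformation up to a factor \<open>c\<close> independent of \<open>z\<close>. Evaluating at the three
  nonzero half periods, where the product of the theta values is known, determines \<open>c ^ 3\<close>.\<close>

lemma theta_inversion:
  assumes t: "Im t > 0"
  obtains c where "c ^ 12 = ee (t + 1 / t)"
    and "\<And>z. theta (z / t) (- 1 / t) = c * ee (z\<^sup>2 / (2 * t)) * theta z t"
proof -
  define t' where "t' = - 1 / t"
  have t': "Im t' > 0"
    unfolding t'_def using t by (rule Im_minus_inverse_pos)
  have [simp]: "t \<noteq> 0"
    using t by auto
  have tt': "1 / t = - t'"
    by (simp add: t'_def)
  \<comment> \<open>The Gaussian turns the quasi-periods of \<open>theta (z / t) (- 1 / t)\<close>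
    into those of \<open>theta z t\<close>.\<close>
  define f where "f z = ee (- z\<^sup>2 / (2 * t)) * theta (z / t) t'" for z
  have theta_sub: "theta (w - t') t' = - ee (w - t' / 2) * theta w t'" for w
  proof -
    have "ee (w - t' / 2) * ee (- (w - t') - t' / 2) = ee 0"
      unfolding ee_add [symmetric] by (rule arg_cong [where f = ee]) (simp add: field_simps)
    then show ?thesis
      using theta_add_t [OF t', of "w - t'"] by (simp add: mult.assoc [symmetric])
  qed
  have "\<exists>c. \<forall>z. f z = c * theta z t"
  proof (rule theta_unique [OF t])
    have "(\<lambda>z. theta z t') \<circ> (\<lambda>z. z / t) holomorphic_on UNIV"
      by (intro holomorphic_on_compose holomorphic_theta_left t' holomorphic_intros) auto
    then show "f holomorphic_on UNIV"
      unfolding f_def o_def by (intro holomorphic_intros) auto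
    have "theta 0 t' = 0"
      using theta_eq_0_iff [OF t'] by (metis add_0 mult_zero_left of_int_0)
    then show "f 0 = 0"
      by (simp add: f_def)
    show "f (z + 1) = - f z" for z
    proof -
      have "theta ((z + 1) / t) t' = - ee (z / t - t' / 2) * theta (z / t) t'"
        using theta_sub [of "z / t"] by (simp add: add_divide_distrib tt')
      moreover have "ee (- (z + 1)\<^sup>2 / (2 * t)) * ee (z / t - t' / 2) = ee (- z\<^sup>2 / (2 * t))"
        by (simp add: ee_add [symmetric] t'_def field_simps power2_eq_square)
      ultimately show ?thesis
        by (simp add: f_def mult.assoc [symmetric])
    qed
    show "f (z + t) = - ee (- z - t / 2) * f z" for z
    proof -
      have "theta ((z + t) / t) t' = - theta (z / t) t'"
        using theta_add_1 [OF t', of "z / t"] by (simp add: add_divide_distrib)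
      moreover have "ee (- (z + t)\<^sup>2 / (2 * t)) = ee (- z - t / 2) * ee (- z\<^sup>2 / (2 * t))"
        unfolding ee_add [symmetric]
        by (rule arg_cong [where f = ee]) (simp add: field_simps power2_eq_square)
      ultimately show ?thesis
        by (simp add: f_def)
    qed
  qed
  then obtain c where c: "\<And>z. f z = c * theta z t"
    by blast
  have th: "theta (z / t) t' = c * ee (z\<^sup>2 / (2 * t)) * theta z t" for z
  proof -
    have "ee (z\<^sup>2 / (2 * t)) * f z = theta (z / t) t'"
      by (simp add: f_def mult.assoc [symmetric] ee_add [symmetric])
    then show ?thesis
      using c [of z] by (simp add: mult_ac)
  qed
  \<comment> \<open>Division by \<open>t\<close> permutes the three half periods modulo the lattice
    of \<open>t'\<close>, with one change of sign in total.\<close>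
  have a1: "theta ((1/2) / t) t' = - theta (t'/2) t'"
    using theta_minus [OF t', of "t'/2"] by (simp add: t'_def mult.commute)
  have a2: "theta ((t/2) / t) t' = theta (1/2) t'"
    by simp
  have a3: "theta (((1 + t)/2) / t) t' = theta ((1 + t')/2) t'"
  proof -
    have "((1 + t)/2) / t = (1 + t')/2 - t'"
      by (simp add: t'_def field_simps)
    moreover have "ee ((1 + t')/2 - t'/2) = -1"
      by (simp add: ee_half add_divide_distrib)
    ultimately show ?thesis
      using theta_sub [of "(1 + t')/2"] by simp
  qed
  have "2 * ee (- t' / 2) = - (theta (1/2) t' * theta (t'/2) t' * theta ((1 + t')/2) t')"
    using theta_half_periods [OF t'] by simp
  also have "\<dots> = theta ((1/2) / t) t' * theta ((t/2) / t) t' * theta (((1 + t)/2) / t) t'"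
    unfolding a1 a2 a3 by (simp add: mult_ac)
  also have "\<dots> = c ^ 3 * (ee ((1/2)\<^sup>2 / (2 * t)) * ee ((t/2)\<^sup>2 / (2 * t)) * ee (((1 + t)/2)\<^sup>2 / (2 * t))) *
      (theta (1/2) t * theta (t/2) t * theta ((1 + t)/2) t)"
    unfolding th by (simp add: power3_eq_cube mult_ac)
  also have "ee ((1/2)\<^sup>2 / (2 * t)) * ee ((t/2)\<^sup>2 / (2 * t)) * ee (((1 + t)/2)\<^sup>2 / (2 * t)) =
      ee (- t' / 4 + 1/4 + t/4)"
    unfolding ee_add [symmetric]
    by (rule arg_cong [where f = ee]) (simp add: t'_def field_simps power2_eq_square)
  also have "\<dots> = \<i> * ee (- t' / 4 + t/4)"
    by (simp only: ee_add ee_quarter mult_ac)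
  also have "theta (1/2) t * theta (t/2) t * theta ((1 + t)/2) t = - 2 * ee (- t / 2)"
    by (rule theta_half_periods [OF t])
  finally have eq: "2 * ee (- t' / 2) = c ^ 3 * (\<i> * ee (- t' / 4 + t/4)) * (- 2 * ee (- t / 2))" .
  have alg: "(- \<i> * K) * (A * B) = X" if "2 * X = K * (\<i> * A) * (- 2 * B)" for X K A B :: complex
  proof -
    have "2 * ((- \<i> * K) * (A * B)) = 2 * X"
      unfolding that by (simp only: mult_minus_left mult_minus_right mult_ac)
    then show ?thesis
      by (simp only: mult_cancel_left) auto
  qed
  have "(- \<i> * c ^ 3) * (ee (- t' / 4 + t/4) * ee (- t / 2)) = ee (- t' / 2)"
    using alg [OF eq] .
  also have "ee (- t' / 4 + t/4) * ee (- t / 2) = ee (- t' / 4 - t/4)"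
    unfolding ee_add [symmetric] by (rule arg_cong [where f = ee]) simp
  finally have "(- \<i> * c ^ 3) = ee (- t' / 2) / ee (- t' / 4 - t/4)"
    by (simp add: eq_divide_eq)
  also have "\<dots> = ee (t/4 - t'/4)"
    unfolding ee_diff [symmetric] by (rule arg_cong [where f = ee]) simp
  \<comment> \<open>The fourth power removes the factor \<open>- \<i>\<close>. No cube root is
    extracted: twelve Siegel functions are always multiplied together, so only \<open>c ^ 12\<close>
    enters.\<close>
  finally have "(- \<i> * c ^ 3) ^ 4 = ee (t/4 - t'/4) ^ 4"
    by (rule arg_cong)
  also have "ee (t/4 - t'/4) ^ 4 = ee (t - t')"
    by (simp add: ee_power algebra_simps)
  also have "(- \<i> * c ^ 3) ^ 4 = c ^ 12"
    by (simp add: power_mult_distrib flip: power_mult)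
  finally have "c ^ 12 = ee (t - t')" .
  then show ?thesis
    using that th by (simp add: t'_def)
qed

section \<open>Siegel functions\<close>

text \<open>Up to the factor \<open>q^(1/12)\<close> this is the Siegel function of the point \<open>x t + y\<close>. The Gaussian
  factor makes it covariant under \<open>SL(2,Z)\<close> acting on \<open>(x, y)\<close>.\<close>

definition klein :: "real \<Rightarrow> real \<Rightarrow> complex \<Rightarrow> complex" where
  "klein x y t = ee (of_real x * (of_real x * t + of_real y) / 2) * theta (of_real x * t + of_real y) t"

lemma klein_translation: "klein x y (t + 1) = klein x (x + y) t"
proof -
  have "ee (t + 1 - z) = ee (t - z)" for z
    by (simp add: ee_diff ee_add)
  then have "theta z (t + 1) = theta z t" for z
    by (simp add: theta_def ee_add)
  then show ?thesis
    by (simp add: klein_def algebra_simps)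
qed

text \<open>The Gaussian of the theta inversion is exactly the change of the prefactor of
  \<open>klein\<close>, so the remaining factor \<open>c\<close> is the same for all
  \<open>x\<close> and \<open>y\<close>. This uniformity lets a product of twelve collect
  \<open>c ^ 12\<close>.\<close>

lemma klein_inversion:
  assumes "Im t > 0"
  obtains c where "c ^ 12 = ee (t + 1 / t)"
    and "\<And>x y. klein (- y) x (- 1 / t) = c * klein x y t"
proof -
  obtain c where c: "c ^ 12 = ee (t + 1 / t)"
    "\<And>z. theta (z / t) (- 1 / t) = c * ee (z\<^sup>2 / (2 * t)) * theta z t"
    using theta_inversion [OF assms] by blast
  have [simp]: "t \<noteq> 0"
    using assms by auto
  have "klein (- y) x (- 1 / t) = c * klein x y t" for x y
  proof -
    define z where "z = of_real x * t + of_real y"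
    have zt: "of_real (- y) * (- 1 / t) + of_real x = z / t"
      by (simp add: z_def field_simps)
    have "ee (of_real (- y) * (z / t) / 2) * ee (z\<^sup>2 / (2 * t)) = ee (of_real x * z / 2)"
      unfolding ee_add [symmetric]
      by (rule arg_cong [where f = ee]) (simp add: z_def field_simps power2_eq_square)
    then show ?thesis
      unfolding klein_def zt z_def [symmetric] c(2) by (simp add: mult_ac)
  qed
  then show ?thesis
    using that c(1) by blast
qed

context
  fixes t :: complex
  assumes t: "Im t > 0"
begin

lemma klein_minus: "klein (- x) (- y) t = - klein x y t"
proof -
  define z where "z = of_real x * t + of_real y"
  have z: "of_real (- x) * t + of_real (- y) = - z"
    by (simp add: z_def)
  show ?thesis
    unfolding klein_def z z_def [symmetric] by (simp add: theta_minus [OF t])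
qed

lemma klein_add_1_right: "klein x (y + 1) t = - ee (of_real x / 2) * klein x y t"
proof -
  define z where "z = of_real x * t + of_real y"
  have z: "of_real x * t + of_real (y + 1) = z + 1"
    by (simp add: z_def)
  have "ee (of_real x * (z + 1) / 2) = ee (of_real x / 2) * ee (of_real x * z / 2)"
    by (simp add: ee_add [symmetric] ring_distribs add_divide_distrib add.commute)
  then show ?thesis
    unfolding klein_def z z_def [symmetric] by (simp add: theta_add_1 [OF t])
qed

lemma klein_add_1_left: "klein (x + 1) y t = - ee (- of_real y / 2) * klein x y t"
proof -
  define z where "z = of_real x * t + of_real y"
  have z: "of_real (x + 1) * t + of_real y = z + t"
    by (simp add: z_def algebra_simps)
  have "ee (of_real (x + 1) * (z + t) / 2) * ee (- z - t / 2) = ee (- of_real y / 2) * ee (of_real x * z / 2)"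
    unfolding ee_add [symmetric]
    by (rule arg_cong [where f = ee]) (simp add: z_def field_simps)
  then show ?thesis
    unfolding klein_def z z_def [symmetric] theta_add_t [OF t] by (simp add: mult_ac)
qed

lemma klein_add_nat_right: "klein x (y + of_nat r) t = (- 1) ^ r * ee (of_nat r * of_real x / 2) * klein x y t"
proof (induction r)
  case (Suc r)
  have "klein x (y + of_nat (Suc r)) t = - ee (of_real x / 2) * klein x (y + of_nat r) t"
    using klein_add_1_right [of x "y + of_nat r"] by (simp add: add_ac)
  moreover have "ee (of_nat (Suc r) * of_real x / 2) = ee (of_real x / 2) * ee (of_nat r * of_real x / 2)"
    by (simp add: ee_add [symmetric] ring_distribs add_divide_distrib)
  ultimately show ?case
    unfolding Suc by (simp only: power_Suc mult_ac mult_minus_left mult_minus_right mult_1)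
qed simp

lemma klein_add_nat_left: "klein (x + of_nat r) y t = (- 1) ^ r * ee (- of_nat r * of_real y / 2) * klein x y t"
proof (induction r)
  case (Suc r)
  have "klein (x + of_nat (Suc r)) y t = - ee (- of_real y / 2) * klein (x + of_nat r) y t"
    using klein_add_1_left [of "x + of_nat r" y] by (simp add: add_ac)
  moreover have "ee (- of_nat (Suc r) * of_real y / 2) = ee (- of_real y / 2) * ee (- of_nat r * of_real y / 2)"
    unfolding ee_add [symmetric] by (rule arg_cong [where f = ee]) (simp add: field_simps)
  ultimately show ?case
    unfolding Suc by (simp only: power_Suc mult_ac mult_minus_left mult_minus_right mult_1)
qed simp

lemma klein_eq_0D: "klein x y t = 0 \<Longrightarrow> x \<in> \<int> \<and> y \<in> \<int>"
proof -
  assume "klein x y t = 0"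
  then obtain m n :: int where mn: "of_real x * t + of_real y = of_int m + of_int n * t"
    using theta_eq_0_iff [OF t] by (auto simp: klein_def)
  from arg_cong [OF mn, of Im] have "x = of_int n"
    using t by simp
  moreover from this arg_cong [OF mn, of Re] have "y = of_int m"
    by simp
  ultimately show ?thesis
    by simp
qed

lemma norm_klein_add_nat_left: "norm (klein (x + of_nat r) y t) = norm (klein x y t)"
  by (simp add: klein_add_nat_left norm_mult norm_power norm_ee)

end

lemma open_halfspace_Im: "open {t. Im t > 0}"
  using open_halfspace_Im_gt [of 0] by simp

lemma holomorphic_klein: "klein x y holomorphic_on {t. Im t > 0}"
proof -
  have "(\<lambda>t. klein x y t) holomorphic_on {t. Im t > 0}"
    unfolding klein_def theta_def
    by (intro holomorphic_intros open_halfspace_Im) (auto intro: norm_ee_less_1)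
  then show ?thesis
    by simp
qed

text \<open>The two exponential prefactors together have modulus
  \<open>exp (pi * Im t * (x - x\<^sup>2))\<close>, and both q-products stay uniformly away from 0
  where \<open>Im t \<ge> 1/2\<close>, the region to which modular reduction leads.\<close>

lemma klein_lower_bound:
  assumes x: "0 \<le> x" "x < 1" and xy: "\<not> (x \<in> \<int> \<and> y \<in> \<int>)"
  obtains c where "c > 0"
    "\<And>t. Im t \<ge> 1/2 \<Longrightarrow> c * exp (pi * Im t * (x - x\<^sup>2)) \<le> norm (klein x y t)"
proof -
  \<comment> \<open>For \<open>x = 0\<close> the critical factor \<open>1 - ee z\<close> is the
    constant \<open>1 - ee y\<close>, nonzero since \<open>y\<close> is then no integer; for
    \<open>x > 0\<close> the decay of \<open>ee z\<close> keeps it away from 0.\<close>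
  define c where "c = (if x = 0 then norm (1 - ee (of_real y)) else 1 - exp (- (pi * x)))"
  have "c > 0"
  proof (cases "x = 0")
    case True
    then have "ee (of_real y) \<noteq> 1"
      using xy unfolding ee_eq_1_iff
      by (metis Ints_0 Ints_of_int of_real_eq_iff of_real_of_int_eq)
    then show ?thesis
      using True by (simp add: c_def)
  qed (use x in \<open>simp add: c_def\<close>)
  define c' where "c' = c / 2 * ((1 - exp (- (pi * (1 - x)))) / 2)"
  have "c' > 0"
    unfolding c'_def using \<open>c > 0\<close> x by (intro mult_pos_pos) auto
  moreover have "c' * exp (pi * Im t * (x - x\<^sup>2)) \<le> norm (klein x y t)" if t: "Im t \<ge> 1/2" for t
  proof -
    define z where "z = of_real x * t + of_real y"
    have Imz: "Im z = x * Im t"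
      by (simp add: z_def)
    have "norm (ee t) \<le> exp (- pi)"
      using t by (simp add: norm_ee)
    also have "exp (- pi) \<le> exp (- 3 :: real)"
      using pi_gt3 by simp
    also have "\<dots> \<le> 1/4"
      using exp_ge_add_one_self [of "3::real"] by (simp add: exp_minus field_simps)
    finally have q: "norm (ee t) \<le> 1/4" .
    have nz: "norm (ee z) \<le> 1"
      using x t by (simp add: norm_ee Imz)
    have "x * Im t \<le> 1 * Im t"
      using x t by (intro mult_right_mono) auto
    then have ntz: "norm (ee (t - z)) \<le> 1"
      by (simp add: norm_ee Imz)
    have "c \<le> norm (1 - ee z)"
    proof (cases "x = 0")
      case False
      have "pi * x * 1 \<le> pi * x * (2 * Im t)"
        using x t by (intro mult_left_mono) auto
      then have "norm (ee z) \<le> exp (- (pi * x))"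
        by (simp add: norm_ee Imz mult_ac)
      moreover have "norm (1::complex) - norm (ee z) \<le> norm (1 - ee z)"
        by (rule norm_triangle_ineq2)
      ultimately show ?thesis
        using False by (simp add: c_def)
    qed (simp add: c_def z_def)
    then have 1: "c / 2 \<le> norm (qpoch (ee z) (ee t))"
      using qpoch_lower_bound [OF q nz] by simp
    have "pi * (1 - x) * 1 \<le> pi * (1 - x) * (2 * Im t)"
      using x t by (intro mult_left_mono) auto
    then have "norm (ee (t - z)) \<le> exp (- (pi * (1 - x)))"
      by (simp add: norm_ee Imz algebra_simps)
    moreover have "norm (1::complex) - norm (ee (t - z)) \<le> norm (1 - ee (t - z))"
      by (rule norm_triangle_ineq2)
    ultimately have 2: "(1 - exp (- (pi * (1 - x)))) / 2 \<le> norm (qpoch (ee (t - z)) (ee t))"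
      using qpoch_lower_bound [OF q ntz] by simp
    have "norm (ee (of_real x * z / 2)) * norm (ee (- z / 2)) = exp (pi * Im t * (x - x\<^sup>2))"
      unfolding norm_ee exp_add [symmetric]
      by (rule arg_cong [where f = exp]) (simp add: Imz field_simps power2_eq_square)
    then have "norm (klein x y t) = exp (pi * Im t * (x - x\<^sup>2)) *
        (norm (qpoch (ee z) (ee t)) * norm (qpoch (ee (t - z)) (ee t)))"
      unfolding klein_def theta_def z_def [symmetric] norm_mult by (simp only: mult.assoc [symmetric])
    moreover have "c' \<le> norm (qpoch (ee z) (ee t)) * norm (qpoch (ee (t - z)) (ee t))"
      unfolding c'_def using 1 2 \<open>c > 0\<close> x by (intro mult_mono) auto
    ultimately show ?thesis
      by (simp add: mult.commute)
  qed
  ultimately show ?thesis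
    using that by blast
qed

section \<open>Products of Siegel functions of level 52\<close>

lemma ee_sum: "ee (\<Sum>i\<in>A. f i) = (\<Prod>i\<in>A. ee (f i))"
  by (induction A rule: infinite_finite_induct) (simp_all add: ee_add)

text \<open>The factor \<open>ee t\<close> compensates the missing \<open>q^(1/12)\<close> of twelve Siegel functions, so the intended
  sets \<open>R\<close> have twelve elements.\<close>

definition modular_unit :: "nat set \<Rightarrow> int \<Rightarrow> int \<Rightarrow> complex \<Rightarrow> complex" where
  "modular_unit R a b t =
     inverse (ee t * (\<Prod>r\<in>R. klein (real r * of_int a / 52) (real r * of_int b / 52) t))"

lemma modular_unit_translation: "modular_unit R a b (t + 1) = modular_unit R a (a + b) t"
  by (simp add: modular_unit_def klein_translation ee_add ring_distribs add_divide_distrib)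

text \<open>Twelve equal factors \<open>c\<close> give \<open>ee (t + 1 / t)\<close>, which is just
  what turns the prefactor \<open>ee (- 1 / t)\<close> into \<open>ee t\<close>.\<close>

lemma modular_unit_inversion:
  assumes t: "Im t > 0" and R: "card R = 12"
  shows "modular_unit R (- b) a (- 1 / t) = modular_unit R a b t"
proof -
  obtain c where c: "c ^ 12 = ee (t + 1 / t)" "\<And>x y. klein (- y) x (- 1 / t) = c * klein x y t"
    using klein_inversion [OF t] by blast
  have "(\<Prod>r\<in>R. klein (real r * of_int (- b) / 52) (real r * of_int a / 52) (- 1 / t)) =
      (\<Prod>r\<in>R. c * klein (real r * of_int a / 52) (real r * of_int b / 52) t)"
    by (intro prod.cong refl) (simp flip: c(2))
  also have "\<dots> = ee (t + 1 / t) * (\<Prod>r\<in>R. klein (real r * of_int a / 52) (real r * of_int b / 52) t)"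
    by (simp add: prod.distrib R c(1))
  finally have "ee (- 1 / t) * (\<Prod>r\<in>R. klein (real r * of_int (- b) / 52) (real r * of_int a / 52) (- 1 / t)) =
      (ee (- 1 / t) * ee (t + 1 / t)) * (\<Prod>r\<in>R. klein (real r * of_int a / 52) (real r * of_int b / 52) t)"
    by (simp only: mult.assoc)
  also have "ee (- 1 / t) * ee (t + 1 / t) = ee t"
    by (simp flip: ee_add)
  finally show ?thesis
    by (simp only: modular_unit_def)
qed

lemma periodic_int_multiple:
  fixes g :: "int \<Rightarrow> 'a"
  assumes "\<And>b. g (b + N) = g b"
  shows "g (b + N * k) = g b"
proof (induction k rule: int_induct [where k = 0])
  case (step1 i)
  then show ?case using assms [of "b + N * i"] by (simp add: algebra_simps)
next
  case (step2 i)
  then show ?case using assms [of "b + N * (i - 1)"] by (simp add: algebra_simps)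
qed simp

context
  fixes R :: "nat set"
  assumes even_sum: "even (\<Sum>R)" and dvd_sum: "104 dvd (\<Sum>r\<in>R. r\<^sup>2)"
begin

text \<open>Moving \<open>a\<close> or \<open>b\<close> by 52 moves the point of index
  \<open>r\<close> by the integer \<open>r\<close>, at the cost of \<open>(- 1) ^ r\<close> and of a
  root of unity whose exponent is an integer multiple of \<open>r\<^sup>2 / 104\<close>. The two
  conditions on \<open>R\<close> make the total cost 1.\<close>

lemma prod_quasi_period: "(\<Prod>r\<in>R. (- 1) ^ r * ee (of_int a * of_nat (r\<^sup>2) / 104)) = (1 :: complex)"
proof -
  obtain k where k: "(\<Sum>r\<in>R. r\<^sup>2) = 104 * k"
    using dvd_sum by auto
  have "(\<Prod>r\<in>R. ee (of_int a * of_nat (r\<^sup>2) / 104)) = ee (\<Sum>r\<in>R. of_int a * of_nat (r\<^sup>2) / 104)"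
    by (rule ee_sum [symmetric])
  also have "(\<Sum>r\<in>R. of_int a * of_nat (r\<^sup>2) / 104 :: complex) = of_int a * of_nat (\<Sum>r\<in>R. r\<^sup>2) / 104"
    by (simp add: sum_distrib_left sum_divide_distrib)
  also have "\<dots> = of_int (a * int k)"
    by (simp add: k)
  also have "ee \<dots> = 1"
    by (rule ee_of_int)
  finally show ?thesis
    using even_sum by (simp add: prod.distrib power_sum [symmetric])
qed

lemma modular_unit_period_right:
  assumes t: "Im t > 0"
  shows "modular_unit R a (b + 52) t = modular_unit R a b t"
proof -
  have "(\<Prod>r\<in>R. klein (real r * of_int a / 52) (real r * of_int (b + 52) / 52) t) =
      (\<Prod>r\<in>R. ((- 1) ^ r * ee (of_int a * of_nat (r\<^sup>2) / 104)) *
        klein (real r * of_int a / 52) (real r * of_int b / 52) t)"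
  proof (rule prod.cong [OF refl])
    fix r
    have "real r * of_int (b + 52) / 52 = real r * of_int b / 52 + of_nat r"
      by (simp add: field_simps)
    moreover have "of_nat r * of_real (real r * of_int a / 52) / 2 = (of_int a * of_nat (r\<^sup>2) / 104 :: complex)"
      by (simp add: power2_eq_square)
    ultimately show "klein (real r * of_int a / 52) (real r * of_int (b + 52) / 52) t =
        ((- 1) ^ r * ee (of_int a * of_nat (r\<^sup>2) / 104)) * klein (real r * of_int a / 52) (real r * of_int b / 52) t"
      by (simp only: klein_add_nat_right [OF t])
  qed
  then show ?thesis
    by (simp only: modular_unit_def prod.distrib [where g = "\<lambda>r. (- 1) ^ r * ee (of_int a * of_nat (r\<^sup>2) / 104)"] prod_quasi_period mult_1)
qed

lemma modular_unit_period_left: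
  assumes t: "Im t > 0"
  shows "modular_unit R (a + 52) b t = modular_unit R a b t"
proof -
  have "(\<Prod>r\<in>R. klein (real r * of_int (a + 52) / 52) (real r * of_int b / 52) t) =
      (\<Prod>r\<in>R. ((- 1) ^ r * ee (of_int (- b) * of_nat (r\<^sup>2) / 104)) *
        klein (real r * of_int a / 52) (real r * of_int b / 52) t)"
  proof (rule prod.cong [OF refl])
    fix r
    have "real r * of_int (a + 52) / 52 = real r * of_int a / 52 + of_nat r"
      by (simp add: field_simps)
    moreover have "- of_nat r * of_real (real r * of_int b / 52) / 2 = (of_int (- b) * of_nat (r\<^sup>2) / 104 :: complex)"
      by (simp add: power2_eq_square)
    ultimately show "klein (real r * of_int (a + 52) / 52) (real r * of_int b / 52) t =
        ((- 1) ^ r * ee (of_int (- b) * of_nat (r\<^sup>2) / 104)) * klein (real r * of_int a / 52) (real r * of_int b / 52) t"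
      by (simp only: klein_add_nat_left [OF t])
  qed
  then show ?thesis
    by (simp only: modular_unit_def prod.distrib [where g = "\<lambda>r. (- 1) ^ r * ee (of_int (- b) * of_nat (r\<^sup>2) / 104)"] prod_quasi_period mult_1)
qed

lemma modular_unit_cong:
  assumes t: "Im t > 0" and "[a = a'] (mod 52)" "[b = b'] (mod 52)"
  shows "modular_unit R a b t = modular_unit R a' b' t"
proof -
  obtain k l where kl: "a' = a + 52 * k" "b' = b + 52 * l"
    using assms(2,3) by (metis cong_iff_lin)
  have "modular_unit R (a + 52 * k) b' t = modular_unit R a b' t"
    using periodic_int_multiple [of "\<lambda>a. modular_unit R a b' t" 52] modular_unit_period_left [OF t] by blast
  moreover have "modular_unit R a (b + 52 * l) t = modular_unit R a b t"
    using periodic_int_multiple [of "\<lambda>b. modular_unit R a b t" 52] modular_unit_period_right [OF t] by blast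
  ultimately show ?thesis
    by (simp add: kl)
qed

end

text \<open>The order at infinity of \<open>modular_unit R a b\<close>, in units of \<open>1 / (2 * 52^2) = 1 / 5408\<close> of a power
  of \<open>q\<close>. One step of \<open>q^(1/52)\<close> is thus 104 units.\<close>

definition cusp_order :: "nat set \<Rightarrow> int \<Rightarrow> int" where
  "cusp_order R a = (\<Sum>r\<in>R. (int r * a mod 52) * (52 - int r * a mod 52)) - 5408"

lemma of_int_divide_in_Ints_iff: "of_int k / 52 \<in> (\<int> :: real set) \<longleftrightarrow> 52 dvd k"
proof
  assume "of_int k / 52 \<in> (\<int> :: real set)"
  then obtain m where "of_int k / 52 = (of_int m :: real)"
    by (auto elim: Ints_cases)
  then have "of_int k = (of_int (52 * m) :: real)"
    by simp
  then have "k = 52 * m"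
    by (simp only: of_int_eq_iff)
  then show "52 dvd k"
    by simp
qed auto

lemma norm_modular_unit_le:
  assumes R: "finite R" and a: "a \<ge> 0"
    and nz: "\<And>r. r \<in> R \<Longrightarrow> \<not> (52 dvd int r * a \<and> 52 dvd int r * b)"
  obtains K where "K > 0"
    "\<And>t. Im t \<ge> 1/2 \<Longrightarrow> norm (modular_unit R a b t) \<le> K * exp (- (2 * pi * Im t * of_int (cusp_order R a) / 5408))"
proof -
  \<comment> \<open>The fractional part of \<open>r * a / 52\<close>: discarding the integer part
    changes a Siegel function only by a factor of modulus 1, and the lower bound is available for
    \<open>0 \<le> x < 1\<close>.\<close>
  define x where "x r = of_int (int r * a mod 52) / (52::real)" for r
  have "\<exists>c>0. \<forall>t. Im t \<ge> 1/2 \<longrightarrow>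
      c * exp (pi * Im t * (x r - (x r)\<^sup>2)) \<le> norm (klein (x r) (real r * of_int b / 52) t)"
    if r: "r \<in> R" for r
  proof (rule klein_lower_bound)
    show "0 \<le> x r" "x r < 1"
      by (simp_all add: x_def)
    have "x r \<in> \<int> \<longleftrightarrow> 52 dvd int r * a"
      unfolding x_def of_int_divide_in_Ints_iff by (simp add: dvd_eq_mod_eq_0)
    moreover have "real r * of_int b / 52 \<in> \<int> \<longleftrightarrow> 52 dvd int r * b"
      using of_int_divide_in_Ints_iff [of "int r * b"] by simp
    ultimately show "\<not> (x r \<in> \<int> \<and> real r * of_int b / 52 \<in> \<int>)"
      using nz [OF r] by blast
  qed blast
  then obtain c where c: "\<And>r. r \<in> R \<Longrightarrow> c r > 0"
    "\<And>r t. r \<in> R \<Longrightarrow> Im t \<ge> 1/2 \<Longrightarrow>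
      c r * exp (pi * Im t * (x r - (x r)\<^sup>2)) \<le> norm (klein (x r) (real r * of_int b / 52) t)"
    by metis
  define C where "C = (\<Prod>r\<in>R. c r)"
  have C: "C > 0"
    unfolding C_def using c(1) by (rule prod_pos)
  have "norm (modular_unit R a b t) \<le> inverse C * exp (- (2 * pi * Im t * of_int (cusp_order R a) / 5408))"
    if t: "Im t \<ge> 1/2" for t
  proof -
    have t0: "Im t > 0"
      using t by simp
    have kl: "norm (klein (real r * of_int a / 52) (real r * of_int b / 52) t) =
        norm (klein (x r) (real r * of_int b / 52) t)" for r
    proof -
      define n where "n = nat (int r * a div 52)"
      have "int n = int r * a div 52"
        using a by (simp add: n_def pos_imp_zdiv_nonneg_iff)
      then have "int r * a = int r * a mod 52 + 52 * int n"
        by simp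
      then have "real r * of_int a = of_int (int r * a mod 52) + 52 * real n"
        by (metis of_int_add of_int_mult of_int_numeral of_int_of_nat_eq)
      then have "real r * of_int a / 52 = x r + of_nat n"
        by (simp add: x_def)
      then show ?thesis
        by (simp only: norm_klein_add_nat_left [OF t0])
    qed
    \<comment> \<open>With \<open>s = 52 * x r\<close> each term is
      \<open>s * (52 - s) / 2704\<close>; the 5408 taken off in \<open>cusp_order\<close> is the
      contribution of \<open>ee t\<close>.\<close>
    have sum: "(\<Sum>r\<in>R. x r - (x r)\<^sup>2) = of_int (cusp_order R a + 5408) / 2704"
      unfolding cusp_order_def
      by (simp add: x_def sum_divide_distrib power2_eq_square algebra_simps diff_divide_distrib)
    have "C * exp (\<Sum>r\<in>R. pi * Im t * (x r - (x r)\<^sup>2)) = (\<Prod>r\<in>R. c r * exp (pi * Im t * (x r - (x r)\<^sup>2)))"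
      by (simp add: C_def prod.distrib exp_sum R)
    also have "\<dots> \<le> (\<Prod>r\<in>R. norm (klein (x r) (real r * of_int b / 52) t))"
      using c t by (intro prod_mono) (auto simp: less_imp_le)
    finally have "C * exp (\<Sum>r\<in>R. pi * Im t * (x r - (x r)\<^sup>2)) \<le>
        norm (\<Prod>r\<in>R. klein (real r * of_int a / 52) (real r * of_int b / 52) t)"
      by (simp add: kl prod_norm [symmetric])
    then have "C * exp (\<Sum>r\<in>R. pi * Im t * (x r - (x r)\<^sup>2)) * exp (- (2 * pi * Im t)) \<le>
        norm (\<Prod>r\<in>R. klein (real r * of_int a / 52) (real r * of_int b / 52) t) * exp (- (2 * pi * Im t))"
      by (rule mult_right_mono) simp
    also have "\<dots> = norm (ee t * (\<Prod>r\<in>R. klein (real r * of_int a / 52) (real r * of_int b / 52) t))"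
      by (simp add: norm_mult norm_ee)
    also have "C * exp (\<Sum>r\<in>R. pi * Im t * (x r - (x r)\<^sup>2)) * exp (- (2 * pi * Im t)) =
        C * exp (2 * pi * Im t * of_int (cusp_order R a) / 5408)"
      unfolding sum_distrib_left [symmetric] sum mult.assoc exp_add [symmetric]
      by (simp add: field_simps)
    finally have "inverse (norm (ee t * (\<Prod>r\<in>R. klein (real r * of_int a / 52) (real r * of_int b / 52) t))) \<le>
        inverse (C * exp (2 * pi * Im t * of_int (cusp_order R a) / 5408))"
      using C by (intro le_imp_inverse_le) auto
    then show ?thesis
      unfolding modular_unit_def norm_inverse exp_minus by (simp only: inverse_mult_distrib [of C])
  qed
  then show ?thesis
    using that [of "inverse C"] C by simp
qed

lemma holomorphic_modular_unit:
  assumes nz: "\<And>r. r \<in> R \<Longrightarrow> \<not> (52 dvd int r * a \<and> 52 dvd int r * b)"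
  shows "modular_unit R a b holomorphic_on {t. Im t > 0}"
proof -
  have "klein (real r * of_int a / 52) (real r * of_int b / 52) t \<noteq> 0" if "Im t > 0" "r \<in> R" for r t
    using klein_eq_0D [OF that(1), of "real r * of_int a / 52" "real r * of_int b / 52"] nz [OF that(2)]
      of_int_divide_in_Ints_iff [of "int r * a"] of_int_divide_in_Ints_iff [of "int r * b"]
    by auto
  then have "(\<lambda>t. modular_unit R a b t) holomorphic_on {t. Im t > 0}"
    unfolding modular_unit_def
    by (cases "finite R")
      (auto intro!: holomorphic_intros holomorphic_klein)
  then show ?thesis
    by simp
qed

section \<open>Vanishing of modular functions of level one\<close>

text \<open>If \<open>|Re t| \<le> 1/2\<close> and \<open>Im t < 1/2\<close> then \<open>|t|^2 \<le> 1/2\<close>, so the inversion at least doubles the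
  imaginary part. This avoids the exact fundamental domain.\<close>

lemma modular_reduction:
  fixes F :: "complex \<Rightarrow> 'a"
  assumes F1: "\<And>t. Im t > 0 \<Longrightarrow> F (t + 1) = F t"
    and FS: "\<And>t. Im t > 0 \<Longrightarrow> F (- 1 / t) = F t"
    and t: "Im t > 0"
  obtains t' where "\<bar>Re t'\<bar> \<le> 1/2" "Im t' \<ge> 1/2" "F t' = F t"
proof -
  have Fint: "F (t + of_int k) = F t" if "Im t > 0" for t k
  proof (induction k rule: int_induct [where k = 0])
    case (step1 i)
    then show ?case using F1 [of "t + of_int i"] that by (simp add: algebra_simps)
  next
    case (step2 i)
    then show ?case using F1 [of "t + of_int (i - 1)"] that by (simp add: algebra_simps)
  qed simp
  \<comment> \<open>Each inversion at least doubles the height, so a point of height at least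
    \<open>(1/2) ^ Suc n\<close> needs at most \<open>n\<close> of them.\<close>
  have "\<exists>t'. \<bar>Re t'\<bar> \<le> 1/2 \<and> Im t' \<ge> 1/2 \<and> F t' = F t" if "Im t \<ge> (1/2) ^ Suc n" for n t
    using that
  proof (induction n arbitrary: t)
    case (0 t)
    have "\<bar>Re (t + of_int (- round (Re t)))\<bar> \<le> 1/2"
      using of_int_round_abs_le [of "Re t"] by (simp add: abs_minus_commute)
    then show ?case
      using 0 Fint [of t "- round (Re t)"] by (intro exI [of _ "t + of_int (- round (Re t))"]) auto
  next
    case (Suc n t)
    define s where "s = t + of_int (- round (Re t))"
    have "(1/2) ^ Suc (Suc n) > (0::real)"
      by simp
    then have t: "Im t > 0"
      using Suc.prems by linarith
    have s: "\<bar>Re s\<bar> \<le> 1/2" "Im s = Im t" "F s = F t"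
      using of_int_round_abs_le [of "Re t"] Fint [OF t, of "- round (Re t)"]
      by (simp_all add: s_def abs_minus_commute)
    show ?case
    proof (cases "Im s \<ge> 1/2")
      case True
      then show ?thesis using s by blast
    next
      case False
      have "(Re s)\<^sup>2 \<le> (1/2)\<^sup>2"
        using s(1) by (subst abs_le_square_iff [symmetric]) auto
      moreover have "(Im s)\<^sup>2 \<le> (1/2)\<^sup>2"
        using False s(2) t by (intro power_mono) auto
      ultimately have le: "(Re s)\<^sup>2 + (Im s)\<^sup>2 \<le> 1/2"
        by (simp add: power2_eq_square)
      have pos: "(Re s)\<^sup>2 + (Im s)\<^sup>2 > 0"
        using s(2) t by (intro add_nonneg_pos) auto
      have "Im (- 1 / s) = Im s / ((Re s)\<^sup>2 + (Im s)\<^sup>2)"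
        by (simp add: Im_divide)
      also have "\<dots> \<ge> Im s / (1/2)"
        using le pos s(2) t by (intro divide_left_mono) auto
      finally have "Im (- 1 / s) \<ge> (1/2) ^ Suc n"
        using Suc.prems s(2) by simp
      from Suc.IH [OF this] show ?thesis
        using FS [of s] s(2,3) t by auto
    qed
  qed
  moreover obtain n where "(1/2) ^ n < Im t"
    using real_arch_pow_inv [OF t, of "1/2"] by auto
  moreover have "(1/2) ^ Suc n \<le> (1/2 :: real) ^ n" for n
    by simp
  ultimately show ?thesis
    using that by (meson less_imp_le order_trans)
qed

text \<open>Decay confines the large values of \<open>P\<close> to bounded height, so by modular
  reduction a maximum of the modulus over a compact box is a maximum over the whole half plane. The
  maximum principle makes \<open>P\<close> constant, which contradicts the decay unless
  \<open>P\<close> is 0.\<close>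

lemma modular_function_vanishes:
  assumes hol: "P holomorphic_on {t. Im t > 0}"
    and P1: "\<And>t. Im t > 0 \<Longrightarrow> P (t + 1) = P t"
    and PS: "\<And>t. Im t > 0 \<Longrightarrow> P (- 1 / t) = P t"
    and c: "c > 0" and bound: "\<And>t. Im t \<ge> 1/2 \<Longrightarrow> norm (P t) \<le> K * exp (- (c * Im t))"
    and t: "Im t > 0"
  shows "P t = 0"
proof (rule ccontr)
  assume nz: "P t \<noteq> 0"
  have "((\<lambda>y. K * exp (- (c * y))) \<longlongrightarrow> 0) at_top"
    using c by real_asymp
  then have "eventually (\<lambda>y. K * exp (- (c * y)) < norm (P t)) at_top"
    using nz by (intro order_tendstoD) auto
  then obtain Y0 where Y0: "\<And>y. y \<ge> Y0 \<Longrightarrow> K * exp (- (c * y)) < norm (P t)"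
    by (auto simp: eventually_at_top_linorder)
  define Y where "Y = max Y0 1"
  have small: "norm (P s) < norm (P t)" if "Im s \<ge> Y" for s
    using bound [of s] Y0 [of "Im s"] that by (auto simp: Y_def)
  define B where "B = cbox (Complex (- 1/2) (1/2)) (Complex (1/2) Y)"
  have B: "s \<in> B \<longleftrightarrow> \<bar>Re s\<bar> \<le> 1/2 \<and> 1/2 \<le> Im s \<and> Im s \<le> Y" for s
    by (auto simp: B_def in_cbox_complex_iff)
  have "continuous_on B P"
    using hol by (rule continuous_on_subset [OF holomorphic_on_imp_continuous_on]) (auto simp: B)
  moreover have "compact B"
    by (simp add: B_def)
  moreover have "Complex 0 1 \<in> B"
    by (simp add: B Y_def)
  ultimately obtain m where m: "m \<in> B" "\<And>s. s \<in> B \<Longrightarrow> norm (P s) \<le> norm (P m)"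
    using continuous_attains_sup [of B "\<lambda>s. norm (P s)"] continuous_on_norm by blast
  have reduce: "norm (P s) \<le> norm (P m) \<or> norm (P s) < norm (P t)" if s: "Im s > 0" for s
  proof -
    obtain s' where s': "\<bar>Re s'\<bar> \<le> 1/2" "Im s' \<ge> 1/2" "P s' = P s"
      using modular_reduction [of P s, OF P1 PS s] by blast
    show ?thesis
      using small [of s'] m(2) [of s'] s' by (cases "Im s' \<le> Y") (auto simp: B)
  qed
  from reduce [OF t] have tm: "norm (P t) \<le> norm (P m)"
    by simp
  have "P constant_on {t. Im t > 0}"
  proof (rule maximum_modulus_principle [OF hol open_halfspace_Im])
    show "connected {t. Im t > 0}"
      by (intro convex_connected convex_halfspace_Im_gt)
    show "m \<in> {t. Im t > 0}"
      using m(1) by (auto simp: B)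
    show "norm (P s) \<le> norm (P m)" if "s \<in> {t. Im t > 0}" for s
      using reduce [of s] tm that by auto
  qed (use open_halfspace_Im in auto)
  moreover have "Im (Complex 0 Y) > 0"
    by (simp add: Y_def)
  ultimately have "P (Complex 0 Y) = P t"
    using t by (auto simp: constant_on_def)
  then show False
    using small [of "Complex 0 Y"] by simp
qed

text \<open>Holomorphic functions on a connected open set form an integral domain: \<open>f\<close>
  vanishes on the open set where \<open>g\<close> does not, and then everywhere by analytic
  continuation.\<close>

lemma holomorphic_mult_eq_0:
  assumes "f holomorphic_on A" "g holomorphic_on A" "open A" "connected A"
    and fg: "\<And>z. z \<in> A \<Longrightarrow> f z * g z = 0"
  shows "(\<forall>z\<in>A. f z = 0) \<or> (\<forall>z\<in>A. g z = 0)"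
proof (rule disjCI)
  assume "\<not> (\<forall>z\<in>A. g z = 0)"
  then obtain w where w: "w \<in> A" "g w \<noteq> 0"
    by blast
  have cont: "continuous_on A g"
    using assms(2) by (rule holomorphic_on_imp_continuous_on)
  define U where "U = A \<inter> g -` (- {0})"
  have "open U"
    unfolding U_def using cont \<open>open A\<close> by (intro continuous_open_preimage) auto
  show "\<forall>z\<in>A. f z = 0"
  proof
    fix z assume "z \<in> A"
    show "f z = 0"
      by (rule analytic_continuation_open [of U A f "\<lambda>_. 0"])
        (use assms w \<open>open U\<close> \<open>z \<in> A\<close> in \<open>auto simp: U_def\<close>)
  qed
qed

lemma holomorphic_prod_eq_0:
  assumes "finite I" "open A" "connected A" "A \<noteq> {}"
    and "\<And>i. i \<in> I \<Longrightarrow> f i holomorphic_on A"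
    and "\<And>z. z \<in> A \<Longrightarrow> (\<Prod>i\<in>I. f i z) = 0"
  shows "\<exists>i\<in>I. \<forall>z\<in>A. f i z = 0"
  using assms(1,5,6)
proof (induction I rule: finite_induct)
  case empty
  then show ?case using \<open>A \<noteq> {}\<close> by auto
next
  case (insert i I)
  have "(\<forall>z\<in>A. f i z = 0) \<or> (\<forall>z\<in>A. (\<Prod>i\<in>I. f i z) = 0)"
  proof (rule holomorphic_mult_eq_0)
    show "(\<lambda>z. \<Prod>i\<in>I. f i z) holomorphic_on A"
      using insert.prems by (intro holomorphic_on_prod) auto
  qed (use insert assms in auto)
  then show ?case
    using insert by auto
qed

section \<open>The defect of the partition identity\<close>

text \<open>The two residue sets of part (i). Parts (ii)--(vi) arise from them by multiplication with
  \<open>3, 5, 7, 9, 11\<close> modulo 52 and sign, where 5 and 11 exchange the roles of the two sets.\<close>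

abbreviation S52 :: "nat set" where
  "S52 \<equiv> {1, 3, 4, 5, 7, 16, 18, 19, 21, 22, 23, 25}"

abbreviation T52 :: "nat set" where
  "T52 \<equiv> {1, 2, 3, 7, 11, 15, 18, 19, 20, 23, 24, 25}"

definition defect :: "int \<Rightarrow> int \<Rightarrow> complex \<Rightarrow> complex" where
  "defect a b t = modular_unit S52 a b t - modular_unit T52 a b t - 1"

text \<open>gcd(a, b, 52) = 1, written out for the primes 2 and 13 dividing 52; equivalently
  \<open>(a, b) / 52\<close> has exact order 52 modulo integer vectors. This form is easy to
  evaluate and to split into cases.\<close>

definition primitive :: "int \<Rightarrow> int \<Rightarrow> bool" where
  "primitive a b \<longleftrightarrow> (odd a \<or> odd b) \<and> (\<not> 13 dvd a \<or> \<not> 13 dvd b)"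

text \<open>A point of exact order 52 has no multiple by \<open>0 < r < 52\<close> in the lattice,
  so no Siegel function in the products vanishes and the defect has no poles in the half
  plane.\<close>

lemma primitive_not_dvd:
  assumes "primitive a b" "r > 0" "r < 52"
  shows "\<not> (52 dvd int r * a \<and> 52 dvd int r * b)"
proof
  assume dvd: "52 dvd int r * a \<and> 52 dvd int r * b"
  have 4: "4 dvd int r * a" "4 dvd int r * b" and 13: "13 dvd int r * a" "13 dvd int r * b"
    using dvd by (auto intro: dvd_trans [of _ 52])
  have "4 dvd int r"
  proof -
    have cop: "coprime 4 x" if "odd x" for x :: int
      using that coprime_power_left_iff [of "2::int" 2 x] by simp
    show ?thesis
      using assms(1) 4 cop [of a] cop [of b]
      by (auto simp: primitive_def coprime_dvd_mult_left_iff)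
  qed
  moreover have "13 dvd int r"
  proof -
    have "prime (13::int)"
      by simp
    then show ?thesis
      using assms(1) 13 by (auto simp: primitive_def prime_dvd_mult_iff)
  qed
  ultimately have "52 dvd int r"
    by presburger
  then show False
    using zdvd_imp_le [of 52 "int r"] assms by simp
qed

lemma defect_translation: "defect a b (t + 1) = defect a (a + b) t"
  by (simp add: defect_def modular_unit_translation)

lemma defect_inversion: "Im t > 0 \<Longrightarrow> defect (- b) a (- 1 / t) = defect a b t"
  unfolding defect_def
  by (intro arg_cong2 [where f = minus] modular_unit_inversion refl) auto

lemma defect_cong:
  "Im t > 0 \<Longrightarrow> [a = a'] (mod 52) \<Longrightarrow> [b = b'] (mod 52) \<Longrightarrow> defect a b t = defect a' b' t"
  \<comment> \<open>What remains for the two sets is arithmetic: the sums 164 and 168 are even, and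
    the sums of squares are 3120 = 104 * 30 and 3224 = 104 * 31.\<close>
  unfolding defect_def
  by (intro arg_cong2 [where f = minus] modular_unit_cong refl) auto

lemma holomorphic_defect:
  assumes "primitive a b"
  shows "defect a b holomorphic_on {t. Im t > 0}"
proof -
  have "(\<lambda>t. defect a b t) holomorphic_on {t. Im t > 0}"
    unfolding defect_def
    by (intro holomorphic_intros holomorphic_modular_unit primitive_not_dvd assms) auto
  then show ?thesis
    by simp
qed

lemma defect_add_of_int: "defect a b (t + of_int k) = defect a (b + k * a) t"
proof (induction k arbitrary: b rule: int_induct [where k = 0])
  case (step1 i)
  have "defect a b (t + of_int (i + 1)) = defect a b ((t + of_int i) + 1)"
    by (simp add: add_ac)
  then show ?case
    unfolding defect_translation step1 by (simp add: algebra_simps)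
next
  case (step2 i)
  have "defect a b (t + of_int (i - 1)) = defect a (a + (b - a)) (t + of_int (i - 1))"
    by simp
  also have "\<dots> = defect a (b - a) (t + of_int i)"
    unfolding defect_translation [symmetric] by (simp add: algebra_simps)
  also have "\<dots> = defect a (b + (i - 1) * a) t"
    unfolding step2 by (simp add: algebra_simps)
  finally show ?case .
qed simp

text \<open>At \<open>a = 1\<close> the expansion of the defect is checked to vanish to order \<open>53 = 5512 / 104\<close>;
  53 is the least number that makes the total order positive.\<close>

definition min_order :: "int \<Rightarrow> int" where
  "min_order a = (if a = 1 then 5512 else min 0 (min (cusp_order S52 a) (cusp_order T52 a)))"

definition primitive_pairs :: "(int \<times> int) set" where
  "primitive_pairs = {(a, b). a \<in> {0..51} \<and> b \<in> {0..51} \<and> primitive a b}"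

lemma finite_primitive_pairs: "finite primitive_pairs"
  by (rule finite_subset [of _ "{0..51} \<times> {0..51}"]) (auto simp: primitive_pairs_def)

text \<open>For \<open>a = 1\<close> all 52 values of \<open>b\<close> are primitive, so these
  factors contribute 52 * 5512, which outweighs all poles of the remaining ones. The order does not
  depend on \<open>b\<close>, so the evaluation runs over \<open>a\<close> with the number of
  admissible \<open>b\<close> as weight.\<close>

lemma sum_min_order: "(\<Sum>(a, b)\<in>primitive_pairs. min_order a) > 0"
proof -
  have "(\<Sum>(a, b)\<in>primitive_pairs. min_order a) =
      (\<Sum>(a, b)\<in>{0..51} \<times> {0..51}. if primitive a b then min_order a else 0)"
    by (rule sum.mono_neutral_cong_left) (auto simp: primitive_pairs_def split: if_splits)
  also have "\<dots> = (\<Sum>a\<in>{0..51}. \<Sum>b\<in>{0..51}. if primitive a b then min_order a else 0)"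
    by (simp add: sum.cartesian_product)
  also have "\<dots> = (\<Sum>a\<in>{0..51}. min_order a * (\<Sum>b\<in>{0..51}. if primitive a b then 1 else 0))"
    by (simp add: sum_distrib_left if_distrib cong: if_cong)
  also have "\<dots> = (\<Sum>a\<leftarrow>[0..51]. min_order a * (\<Sum>b\<leftarrow>[0..51]. if primitive a b then 1 else 0))"
    by (simp only: interv_sum_list_conv_sum_set_int set_upto)
  also have "\<dots> > 0"
    unfolding min_order_def cusp_order_def primitive_def
    by code_simp
  finally show ?thesis .
qed

section \<open>Transitivity of SL(2,Z) on primitive pairs\<close>

context
  fixes V :: "int \<Rightarrow> int \<Rightarrow> bool"
  defines "V \<equiv> \<lambda>a b. \<forall>t. Im t > 0 \<longrightarrow> defect a b t = 0"
begin

private lemma V_shift: "V a b \<Longrightarrow> V a (b + k * a)"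
  unfolding V_def defect_add_of_int [symmetric] by simp

private lemma V_rotate: "V a b \<Longrightarrow> V (- b) a"
proof -
  assume V: "V a b"
  have "defect (- b) a t = 0" if t: "Im t > 0" for t
  proof -
    have "defect (- b) a (- 1 / (- 1 / t)) = defect a b (- 1 / t)"
      using t by (intro defect_inversion Im_minus_inverse_pos)
    then show ?thesis
      using V Im_minus_inverse_pos [OF t] by (simp add: V_def)
  qed
  then show ?thesis
    by (simp add: V_def)
qed

private lemma V_minus: "V a b \<Longrightarrow> V (- a) (- b)"
  using V_rotate V_rotate by blast

private lemma V_shift_left: "V a b \<Longrightarrow> V (a + k * b) b"
proof -
  assume "V a b"
  then have "V (- b) (a + (- k) * (- b))"
    by (intro V_shift V_rotate)
  from V_minus [OF V_rotate [OF this]] show ?thesis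
    by (simp add: add.commute)
qed

private lemma V_cong: "V a b \<Longrightarrow> [a = a'] (mod 52) \<Longrightarrow> [b = b'] (mod 52) \<Longrightarrow> V a' b'"
  unfolding V_def using defect_cong by metis

private lemma coprime_52I: "odd a \<Longrightarrow> \<not> 13 dvd a \<Longrightarrow> coprime a (52::int)"
proof -
  assume "odd a" "\<not> 13 dvd a"
  then have "coprime a 2" "coprime a 13"
    using prime_imp_coprime [of "13::int" a] by (auto simp: coprime_commute)
  then have "coprime a (2 * 2 * 13)"
    by (simp only: coprime_mult_right_iff)
  then show ?thesis
    by simp
qed

lemma defect_vanishing_transitive:
  assumes "primitive a b" "\<And>t. Im t > 0 \<Longrightarrow> defect a b t = 0"
    and m: "odd m" "\<not> 13 dvd m" and t: "Im t > 0"
  shows "defect m 0 t = 0"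
proof -
  have ab: "V a b"
    using assms(2) by (simp add: V_def)
  \<comment> \<open>The aim is a first entry that is a unit modulo 52. Since 14 is even and 1 modulo
    13, adding \<open>14 * b\<close> repairs only the residue modulo 13; adding
    \<open>13 * b\<close> repairs only the parity; adding \<open>b\<close> repairs both.\<close>
  obtain k where k: "odd (a + k * b)" "\<not> 13 dvd (a + k * b)"
  proof -
    consider "odd a" "\<not> 13 dvd a" | "odd a" "13 dvd a" "\<not> 13 dvd b"
      | "even a" "odd b" "\<not> 13 dvd a" | "even a" "odd b" "13 dvd a" "\<not> 13 dvd b"
      using assms(1) by (auto simp: primitive_def)
    then show ?thesis
    proof cases
      case 1
      then show ?thesis using that [of 0] by simp
    next
      case 2
      then have "\<not> 13 dvd (14 * b)"
        by presburger
      then show ?thesis using that [of 14] 2 by (simp add: dvd_add_right_iff)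
    next
      case 3
      then show ?thesis using that [of 13] by (simp add: dvd_add_left_iff)
    next
      case 4
      then show ?thesis using that [of 1] by (simp add: dvd_add_right_iff)
    qed
  qed
  define a' where "a' = a + k * b"
  have a': "V a' b"
    unfolding a'_def using ab by (rule V_shift_left)
  have "coprime a' 52"
    unfolding a'_def using k by (rule coprime_52I)
  then obtain x where x: "[a' * x = 1] (mod 52)"
    using cong_solve_coprime_int by blast
  \<comment> \<open>As \<open>a'\<close> is invertible, a multiple of it carries \<open>b\<close> to
    \<open>m\<close>; below, the unit \<open>m\<close> clears the first entry in the same
    way.\<close>
  have "[b + (x * (m - b)) * a' = m] (mod 52)"
  proof -
    have "[(a' * x) * (m - b) = 1 * (m - b)] (mod 52)"
      using x by (rule cong_mult) simp
    from cong_add [OF cong_refl this, of b] show ?thesis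
      by (simp add: mult_ac)
  qed
  with V_shift [OF a'] have am: "V a' m"
    using V_cong cong_refl by blast
  have "coprime m 52"
    using m by (rule coprime_52I)
  then obtain y where y: "[m * y = 1] (mod 52)"
    using cong_solve_coprime_int by blast
  have "[a' + (- a' * y) * m = 0] (mod 52)"
  proof -
    have "[(m * y) * (- a') = 1 * (- a')] (mod 52)"
      using y by (rule cong_mult) simp
    from cong_add [OF cong_refl this, of a'] show ?thesis
      by (simp add: mult_ac)
  qed
  with V_shift_left [OF am] have "V 0 m"
    using V_cong cong_refl by blast
  from V_minus [OF V_rotate [OF this]] have "V m 0"
    by simp
  then show ?thesis
    using t by (simp add: V_def)
qed

end

section \<open>Generating functions of partitions\<close>

lemma size_le_sum_mset: "0 \<notin># P \<Longrightarrow> size P \<le> sum_mset P" for P :: "nat multiset"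
proof (induction P)
  case (add x P)
  then show ?case by (cases x) auto
qed simp

lemma finite_partitions:
  assumes "0 \<notin> S"
  shows "finite {P :: nat multiset. set_mset P \<subseteq> S \<and> sum_mset P = n}"
proof (rule finite_subset)
  show "{P. set_mset P \<subseteq> S \<and> sum_mset P = n} \<subseteq> mset ` {xs. set xs \<subseteq> {..n} \<and> length xs \<le> n}"
  proof
    fix P :: "nat multiset" assume "P \<in> {P. set_mset P \<subseteq> S \<and> sum_mset P = n}"
    then have P: "set_mset P \<subseteq> S" "sum_mset P = n"
      by auto
    obtain xs where xs: "mset xs = P"
      using ex_mset by blast
    have "x \<le> n" if "x \<in># P" for x
      using that P(2) by (metis multi_member_split le_add1 sum_mset.add_mset)
    moreover have "size P \<le> n"
      using size_le_sum_mset [of P] P assms by auto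
    ultimately show "P \<in> mset ` {xs. set xs \<subseteq> {..n} \<and> length xs \<le> n}"
      using xs by (intro image_eqI [of _ _ xs]) (auto simp flip: set_mset_mset)
  qed
  show "finite (mset ` {xs :: nat list. set xs \<subseteq> {..n} \<and> length xs \<le> n})"
    by (intro finite_imageI finite_lists_length_le) simp
qed

lemma num_partitions_empty: "num_partitions {} n = (if n = 0 then 1 else 0)"
proof -
  have "{P :: nat multiset. set_mset P \<subseteq> {} \<and> sum_mset P = n} = (if n = 0 then {{#}} else {})"
    by auto
  then show ?thesis
    by (simp add: num_partitions_def)
qed

lemma num_partitions_mono:
  assumes "A \<subseteq> S" "0 \<notin> S"
  shows "num_partitions A n \<le> num_partitions S n"
  unfolding num_partitions_def using assms by (intro card_mono finite_partitions) auto

lemma num_partitions_cong: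
  assumes "S \<inter> {..n} \<subseteq> A" "A \<subseteq> S"
  shows "num_partitions A n = num_partitions S n"
proof -
  have "x \<le> n" if "x \<in># P" "sum_mset P = n" for x and P :: "nat multiset"
    using that by (metis multi_member_split le_add1 sum_mset.add_mset)
  then have "{P :: nat multiset. set_mset P \<subseteq> A \<and> sum_mset P = n} = {P. set_mset P \<subseteq> S \<and> sum_mset P = n}"
    using assms by blast
  then show ?thesis
    by (simp add: num_partitions_def)
qed

text \<open>Partitions are split by whether \<open>s\<close> occurs; if it does, one copy is
  removed. The same recursion drives the generating function and the computation of
  coefficients.\<close>

lemma num_partitions_insert:
  assumes "0 \<notin> A" "s \<notin> A" "s > 0"
  shows "num_partitions (insert s A) n =
    num_partitions A n + (if s \<le> n then num_partitions (insert s A) (n - s) else 0)"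
proof -
  define X where "X A n = {P :: nat multiset. set_mset P \<subseteq> A \<and> sum_mset P = n}" for A n
  have fin: "finite (X A n)" "finite (X (insert s A) n)" for n
    unfolding X_def using assms by (auto intro!: finite_partitions)
  have np: "num_partitions A n = card (X A n)" for A n
    by (simp add: num_partitions_def X_def)
  have eq: "X (insert s A) n = X A n \<union> (if s \<le> n then add_mset s ` X (insert s A) (n - s) else {})"
  proof (intro equalityI subsetI)
    fix P assume P: "P \<in> X (insert s A) n"
    show "P \<in> X A n \<union> (if s \<le> n then add_mset s ` X (insert s A) (n - s) else {})"
    proof (cases "s \<in># P")
      case True
      then obtain Q where "P = add_mset s Q"
        by (meson multi_member_split)
      then show ?thesis
        using P by (auto simp: X_def)
    next
      case False
      then show ?thesis
        using P by (auto simp: X_def)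
    qed
  qed (auto simp: X_def split: if_splits)
  have "X A n \<inter> add_mset s ` X (insert s A) (n - s) = {}"
  proof -
    have "s \<in># P" if "P \<in> add_mset s ` X (insert s A) (n - s)" for P
      using that by auto
    moreover have "s \<notin># P" if "P \<in> X A n" for P
      using that assms(2) unfolding X_def by blast
    ultimately show ?thesis
      by blast
  qed
  moreover have "card (add_mset s ` X (insert s A) (n - s)) = card (X (insert s A) (n - s))"
    by (intro card_image inj_onI) simp
  ultimately show ?thesis
    unfolding np by (subst eq) (simp add: card_Un_disjoint fin)
qed

lemma sums_shift:
  fixes f :: "nat \<Rightarrow> 'a :: real_normed_field"
  assumes "(\<lambda>n. f n * z ^ n) sums F"
  shows "(\<lambda>n. (if k \<le> n then f (n - k) else 0) * z ^ n) sums (z ^ k * F)"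
proof -
  define g where "g n = (if k \<le> n then f (n - k) else 0) * z ^ n" for n
  have "(\<lambda>n. g (n + k)) sums (z ^ k * F)"
    using sums_mult [OF assms, of "z ^ k"] by (simp add: g_def power_add mult_ac)
  then have "g sums (z ^ k * F + (\<Sum>n<k. g n))"
    by (simp only: sums_iff_shift)
  moreover have "(\<Sum>n<k. g n) = 0"
    by (rule sum.neutral) (simp add: g_def)
  ultimately show ?thesis
    by (simp flip: g_def)
qed

text \<open>By the recursion, \<open>F - z ^ s * F\<close> is the series of the smaller set of
  parts. Absolute summability is carried through the induction, since this equation can be solved
  for \<open>F\<close> only once the series of \<open>F\<close> is known to converge.\<close>

lemma partition_series_finite:
  assumes "finite A" "0 \<notin> A" and z: "norm z < 1"
  shows "summable (\<lambda>n. real (num_partitions A n) * norm z ^ n) \<and>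
    (\<lambda>n. of_nat (num_partitions A n) * z ^ n) sums inverse (\<Prod>s\<in>A. 1 - z ^ s :: complex)"
  using assms(1,2)
proof (induction A rule: finite_induct)
  case empty
  have "(\<lambda>n. of_nat (num_partitions {} n) * z ^ n) = (\<lambda>n. if n = 0 then 1 else 0)"
    and "(\<lambda>n. real (num_partitions {} n) * norm z ^ n) = (\<lambda>n. if n = 0 then 1 else 0)"
    by (auto simp: num_partitions_empty)
  moreover have "(\<lambda>n. if n = 0 then 1 else 0) sums (1 :: complex)"
    using sums_single [of 0 "\<lambda>_. 1 :: complex"] by simp
  moreover have "summable (\<lambda>n. if n = 0 then 1 else 0 :: real)"
    using sums_single [of 0 "\<lambda>_. 1 :: real"] by (simp add: sums_iff)
  ultimately show ?case
    by simp
next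
  case (insert s A)
  define p where "p = num_partitions A"
  define p' where "p' = num_partitions (insert s A)"
  have s: "s > 0"
    using insert by (cases s) auto
  have rec: "p' n = p n + (if s \<le> n then p' (n - s) else 0)" for n
    unfolding p_def p'_def using insert s by (intro num_partitions_insert) auto
  define t where "t = norm z"
  have t: "0 \<le> t" "t ^ s < 1"
    using z s by (auto simp: t_def power_less_one_iff)
  have sum_shift: "(\<Sum>n<N. (if s \<le> n then real (p' (n - s)) else 0) * t ^ n) \<le> t ^ s * (\<Sum>n<N. real (p' n) * t ^ n)" for N
  proof -
    have "(\<Sum>n<N. (if s \<le> n then real (p' (n - s)) else 0) * t ^ n) = (\<Sum>n\<in>{s..<N}. real (p' (n - s)) * t ^ n)"
      by (rule sum.mono_neutral_cong_right) auto
    also have "\<dots> = (\<Sum>n<N - s. real (p' n) * t ^ (n + s))"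
      by (rule sum.reindex_bij_witness [of _ "\<lambda>n. n + s" "\<lambda>n. n - s"]) auto
    also have "\<dots> \<le> (\<Sum>n<N. real (p' n) * t ^ (n + s))"
      using t by (intro sum_mono2) auto
    finally show ?thesis
      by (simp add: sum_distrib_left power_add mult_ac)
  qed
  have sp: "summable (\<lambda>n. real (p n) * t ^ n)"
    using insert by (simp add: p_def t_def)
  have sp': "summable (\<lambda>n. real (p' n) * t ^ n)"
  proof (rule summableI_nonneg_bounded)
    show "0 \<le> real (p' n) * t ^ n" for n
      using t by simp
    \<comment> \<open>A partial sum is at most the full series of \<open>p\<close> plus
      \<open>t ^ s\<close> times itself; \<open>t ^ s < 1\<close> allows solving for it.\<close>
    show "(\<Sum>n<N. real (p' n) * t ^ n) \<le> (\<Sum>n. real (p n) * t ^ n) / (1 - t ^ s)" for N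
    proof -
      have "(\<Sum>n<N. real (p' n) * t ^ n) =
          (\<Sum>n<N. real (p n) * t ^ n) + (\<Sum>n<N. (if s \<le> n then real (p' (n - s)) else 0) * t ^ n)"
        unfolding sum.distrib [symmetric] by (rule sum.cong [OF refl], subst rec) (simp add: algebra_simps)
      also have "(\<Sum>n<N. real (p n) * t ^ n) \<le> (\<Sum>n. real (p n) * t ^ n)"
        using sp t by (intro sum_le_suminf) auto
      finally show ?thesis
        using sum_shift [of N] t by (simp add: field_simps)
    qed
  qed
  have csum: "summable (\<lambda>n. of_nat (p' n) * z ^ n)"
    by (rule summable_norm_cancel) (use sp' in \<open>simp add: norm_mult norm_power t_def\<close>)
  define F where "F = (\<Sum>n. of_nat (p' n) * z ^ n)"
  have F: "(\<lambda>n. of_nat (p' n) * z ^ n) sums F"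
    unfolding F_def using csum by (rule summable_sums)
  have "(\<lambda>n. (if s \<le> n then of_nat (p' (n - s)) else 0) * z ^ n) sums (z ^ s * F)"
    using F by (rule sums_shift)
  from sums_diff [OF F this] have "(\<lambda>n. of_nat (p' n) * z ^ n -
      (if s \<le> n then of_nat (p' (n - s)) else 0) * z ^ n) sums (F - z ^ s * F)" .
  moreover have "of_nat (p' n) * z ^ n - (if s \<le> n then of_nat (p' (n - s)) else 0) * z ^ n =
      of_nat (p n) * z ^ n" for n
    by (subst rec) (simp add: algebra_simps)
  ultimately have "(\<lambda>n. of_nat (p n) * z ^ n) sums (F - z ^ s * F)"
    by simp
  moreover have "(\<lambda>n. of_nat (p n) * z ^ n) sums inverse (\<Prod>s\<in>A. 1 - z ^ s)"
    using insert by (simp add: p_def)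
  ultimately have "F - z ^ s * F = inverse (\<Prod>s\<in>A. 1 - z ^ s)"
    by (rule sums_unique2)
  moreover have "1 - z ^ s \<noteq> 0"
  proof
    assume "1 - z ^ s = 0"
    then have "norm (z ^ s) = 1"
      by simp
    then show False
      using t by (simp add: t_def norm_power)
  qed
  ultimately have "F = inverse (\<Prod>s\<in>A. 1 - z ^ s) / (1 - z ^ s)"
    by (simp add: eq_divide_eq algebra_simps)
  then have "F = inverse (\<Prod>s\<in>insert s A. 1 - z ^ s)"
    using insert.hyps by (simp add: divide_inverse)
  then show ?case
    using sp' F by (simp add: p'_def t_def)
qed

text \<open>The finite sets \<open>A N\<close> contain every part up to \<open>N\<close>, so their
  coefficients up to \<open>N\<close> are already final. The second limit, at the real point
  \<open>norm z\<close>, bounds the partial sums of the nonnegative series and thereby provides the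
  majorant for exchanging limit and sum by Tannery's theorem.\<close>

lemma partition_series:
  fixes z :: complex
  assumes S: "0 \<notin> S" and z: "norm z < 1"
    and A: "\<And>N. finite (A N)" "\<And>N. S \<inter> {..N} \<subseteq> A N" "\<And>N. A N \<subseteq> S"
    and L: "(\<lambda>N. \<Prod>s\<in>A N. 1 - z ^ s) \<longlonglongrightarrow> L" "L \<noteq> 0"
    and L': "(\<lambda>N. \<Prod>s\<in>A N. 1 - complex_of_real (norm z) ^ s) \<longlonglongrightarrow> L'" "L' \<noteq> 0"
  shows "summable (\<lambda>n. real (num_partitions S n) * norm z ^ n)"
    and "(\<lambda>n. of_nat (num_partitions S n) * z ^ n) sums inverse L"
proof -
  define t where "t = norm z"
  have t: "0 \<le> t" "t < 1"
    using z by (auto simp: t_def)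
  have A0: "0 \<notin> A N" for N
    using S A(3) by blast
  have eq: "num_partitions (A N) n = num_partitions S n" if "n \<le> N" for n N
    using A(2) [of N] A(3) [of N] that by (intro num_partitions_cong) auto
  have "(\<lambda>N. inverse (\<Prod>s\<in>A N. 1 - of_real t ^ s)) \<longlonglongrightarrow> inverse L'"
    unfolding t_def using L' by (rule tendsto_inverse)
  then have "Bseq (\<lambda>N. inverse (\<Prod>s\<in>A N. 1 - complex_of_real t ^ s))"
    by (intro convergent_imp_Bseq convergentI)
  then obtain B where B: "\<And>N. norm (inverse (\<Prod>s\<in>A N. 1 - complex_of_real t ^ s)) \<le> B"
    unfolding Bseq_def by blast
  show sm: "summable (\<lambda>n. real (num_partitions S n) * norm z ^ n)"
  proof (rule summableI_nonneg_bounded)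
    fix N
    have nt: "norm (complex_of_real t) < 1"
      using t by simp
    note ps = partition_series_finite [OF A(1) [of N] A0 nt]
    have sums: "(\<lambda>n. real (num_partitions (A N) n) * t ^ n) sums norm (inverse (\<Prod>s\<in>A N. 1 - complex_of_real t ^ s))"
    proof -
      define Y where "Y = (\<Sum>n. real (num_partitions (A N) n) * t ^ n)"
      have Y: "(\<lambda>n. real (num_partitions (A N) n) * t ^ n) sums Y"
        unfolding Y_def using ps t by (intro summable_sums) simp
      then have "(\<lambda>n. complex_of_real (real (num_partitions (A N) n) * t ^ n)) sums of_real Y"
        by (rule sums_of_real)
      then have "complex_of_real Y = inverse (\<Prod>s\<in>A N. 1 - complex_of_real t ^ s)"
        using ps by (intro sums_unique2) auto
      moreover have "Y \<ge> 0"
        unfolding Y_def using t Y by (intro suminf_nonneg) (auto simp: sums_iff)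
      ultimately show ?thesis
        using Y by (metis norm_of_real abs_of_nonneg)
    qed
    have "(\<Sum>n<N. real (num_partitions S n) * norm z ^ n) = (\<Sum>n<N. real (num_partitions (A N) n) * t ^ n)"
      by (intro sum.cong) (auto simp: eq t_def)
    also have "\<dots> \<le> (\<Sum>n. real (num_partitions (A N) n) * t ^ n)"
      using sums t by (intro sum_le_suminf) (auto simp: sums_iff)
    also have "\<dots> = norm (inverse (\<Prod>s\<in>A N. 1 - complex_of_real t ^ s))"
      using sums by (simp add: sums_iff)
    also have "\<dots> \<le> B"
      by (rule B)
    finally show "(\<Sum>n<N. real (num_partitions S n) * norm z ^ n) \<le> B" .
  qed simp
  have cs: "summable (\<lambda>n. of_nat (num_partitions S n) * z ^ n)"
    by (rule summable_norm_cancel) (use sm in \<open>simp add: norm_mult norm_power\<close>)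
  have "(\<lambda>N. \<Sum>n. of_nat (num_partitions (A N) n) * z ^ n) \<longlonglongrightarrow> (\<Sum>n. of_nat (num_partitions S n) * z ^ n)"
  proof (rule tannerys_theorem [THEN conjunct2, THEN conjunct2])
    show "((\<lambda>N. of_nat (num_partitions (A N) n) * z ^ n) \<longlonglongrightarrow> of_nat (num_partitions S n) * z ^ n)" for n
      by (rule tendsto_eventually) (use eventually_ge_at_top [of n] in \<open>eventually_elim, simp add: eq\<close>)
    show "\<forall>\<^sub>F (n, N) in sequentially \<times>\<^sub>F sequentially.
        norm (of_nat (num_partitions (A N) n) * z ^ n) \<le> real (num_partitions S n) * norm z ^ n"
      by (rule always_eventually)
        (auto simp: norm_mult norm_power intro!: mult_right_mono num_partitions_mono A S)
  qed (use sm in auto)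
  moreover have "(\<Sum>n. of_nat (num_partitions (A N) n) * z ^ n) = inverse (\<Prod>s\<in>A N. 1 - z ^ s)" for N
    using partition_series_finite [OF A(1) [of N] A0 z] by (auto simp: sums_iff)
  ultimately have "(\<lambda>N. inverse (\<Prod>s\<in>A N. 1 - z ^ s)) \<longlonglongrightarrow> (\<Sum>n. of_nat (num_partitions S n) * z ^ n)"
    by simp
  moreover have "(\<lambda>N. inverse (\<Prod>s\<in>A N. 1 - z ^ s)) \<longlonglongrightarrow> inverse L"
    using L by (rule tendsto_inverse)
  ultimately have "(\<Sum>n. of_nat (num_partitions S n) * z ^ n) = inverse L"
    by (rule LIMSEQ_unique)
  then show "(\<lambda>n. of_nat (num_partitions S n) * z ^ n) sums inverse L"
    using cs by (simp add: sums_iff)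
qed

section \<open>Parts in residue classes modulo 52\<close>

lemma pm_residues_iff:
  assumes "R \<subseteq> {1..25}"
  shows "n \<in> pm_residues (int ` R) 52 \<longleftrightarrow> n mod 52 \<in> R \<or> n mod 52 \<in> (\<lambda>r. 52 - r) ` R"
proof -
  have n: "int n mod 52 = int (n mod 52)"
    by (simp add: zmod_int)
  have 1: "[int n = int r] (mod 52) \<longleftrightarrow> n mod 52 = r" if "r \<in> R" for r
  proof -
    have "r < 52"
      using that assms by auto
    then have "int r mod 52 = int r"
      by simp
    then show ?thesis
      unfolding unique_euclidean_semiring_class.cong_def n by (simp only: of_nat_eq_iff)
  qed
  have 2: "[int n = - int r] (mod 52) \<longleftrightarrow> n mod 52 = 52 - r" if "r \<in> R" for r
  proof -
    have "r < 52" "r > 0"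
      using that assms by auto
    then have "- int r mod 52 = int (52 - r)"
      by (simp add: zmod_zminus1_eq_if of_nat_diff)
    then show ?thesis
      unfolding unique_euclidean_semiring_class.cong_def n by (simp only: of_nat_eq_iff)
  qed
  \<comment> \<open>The residues lie in 1, ..., 25, so neither they nor their complements are 0
    modulo 52, and \<open>n = 0\<close> is excluded automatically.\<close>
  have "n mod 52 \<in> R \<or> n mod 52 \<in> (\<lambda>r. 52 - r) ` R \<Longrightarrow> n > 0"
    using assms by (cases "n = 0") auto
  moreover have "(\<exists>r\<in>int ` R. [int n = r] (mod 52) \<or> [int n = - r] (mod 52)) \<longleftrightarrow>
      n mod 52 \<in> R \<or> n mod 52 \<in> (\<lambda>r. 52 - r) ` R"
    using 1 2 by auto
  ultimately show ?thesis
    unfolding pm_residues_def by blast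
qed

text \<open>At \<open>z = ee (t / 52)\<close> this is \<open>theta (r * t / 52) t\<close> without
  its exponential prefactor.\<close>

definition residue_prod :: "complex \<Rightarrow> nat \<Rightarrow> complex" where
  "residue_prod z r = qpoch (z ^ r) (z ^ 52) * qpoch (z ^ (52 - r)) (z ^ 52)"

lemma residue_prod_nonzero:
  assumes z: "norm z < 1" and r: "0 < r" "r < 52"
  shows "residue_prod z r \<noteq> 0"
proof -
  have "norm (z ^ 52) < 1"
    using z by (simp add: norm_power power_less_one_iff)
  moreover have "z ^ k * (z ^ 52) ^ n \<noteq> 1" if "k > 0" for k n
  proof
    assume "z ^ k * (z ^ 52) ^ n = 1"
    then have "norm (z ^ (k + 52 * n)) = 1"
      by (simp add: power_add power_mult)
    moreover have "norm (z ^ (k + 52 * n)) < 1"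
      unfolding norm_power by (subst power_less_one_iff) (use z that in auto)
    ultimately show False
      by simp
  qed
  ultimately show ?thesis
    using r by (simp add: residue_prod_def qpoch_eq_0_iff)
qed

context
  fixes R :: "nat set"
  assumes R: "R \<subseteq> {1..25}"
begin

private lemma finite_R: "finite R"
  using R by (rule finite_subset) simp

lemma zero_notin_pm_residues: "0 \<notin> pm_residues (int ` R) 52"
  by (simp add: pm_residues_def)

text \<open>Cutting at a multiple of the period 52 gives each class exactly \<open>N\<close> parts.
  The classes do not overlap, since the residues are at most 25 and their complements at least
  27.\<close>

lemma prod_pm_residues:
  fixes z :: complex
  shows "(\<Prod>s | s \<in> pm_residues (int ` R) 52 \<and> s < 52 * N. 1 - z ^ s) =
    (\<Prod>r\<in>R. (\<Prod>n<N. 1 - z ^ r * (z ^ 52) ^ n) * (\<Prod>n<N. 1 - z ^ (52 - r) * (z ^ 52) ^ n))"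
proof -
  define f where "f = (\<lambda>(r, n). 52 * n + r :: nat)"
  define g where "g = (\<lambda>(r, n). 52 * n + (52 - r) :: nat)"
  let ?I = "R \<times> {..<N}"
  have lt: "0 < r \<and> r \<le> 25" if "r \<in> R" for r
    using R that by auto
  have dm: "(52 * n + k) mod 52 = k" "(52 * n + k) div 52 = n" if "k < 52" for k n :: nat
    using that by simp_all
  have f: "f (r, n) mod 52 = r" "f (r, n) div 52 = n" and g: "g (r, n) mod 52 = 52 - r" "g (r, n) div 52 = n"
    if "r \<in> R" for r n
    unfolding f_def g_def prod.case using lt [OF that] by (auto intro!: dm simp del: add_diff_assoc)
  have injf: "inj_on f ?I"
  proof (rule inj_onI, clarify)
    fix r n r' n' assume *: "r \<in> R" "r' \<in> R" "f (r, n) = f (r', n')"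
    show "r = r' \<and> n = n'"
      using f(1) [OF *(1), of n] f(1) [OF *(2), of n'] f(2) [OF *(1), of n] f(2) [OF *(2), of n'] *(3) by metis
  qed
  have injg: "inj_on g ?I"
  proof (rule inj_onI, clarify)
    fix r n r' n' assume *: "r \<in> R" "r' \<in> R" "g (r, n) = g (r', n')"
    have "52 - r = 52 - r'" "n = n'"
      using g(1) [OF *(1), of n] g(1) [OF *(2), of n'] g(2) [OF *(1), of n] g(2) [OF *(2), of n'] *(3) by metis+
    then show "r = r' \<and> n = n'"
      using lt [OF *(1)] lt [OF *(2)] by linarith
  qed
  have disj: "f ` ?I \<inter> g ` ?I = {}"
  proof -
    have "f (r, n) \<noteq> g (r', n')" if "r \<in> R" "r' \<in> R" for r n r' n'
    proof
      assume eq: "f (r, n) = g (r', n')"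
      have "r = 52 - r'"
        using f(1) [OF that(1), of n] g(1) [OF that(2), of n'] unfolding eq by simp
      then show False
        using lt [OF that(1)] lt [OF that(2)] by linarith
    qed
    then show ?thesis
      by auto
  qed
  have eq: "{s. s \<in> pm_residues (int ` R) 52 \<and> s < 52 * N} = f ` ?I \<union> g ` ?I"
  proof (intro equalityI subsetI)
    fix s assume "s \<in> {s. s \<in> pm_residues (int ` R) 52 \<and> s < 52 * N}"
    then have s: "s mod 52 \<in> R \<or> s mod 52 \<in> (\<lambda>r. 52 - r) ` R" "s < 52 * N"
      by (simp_all add: pm_residues_iff [OF R])
    have N: "s div 52 < N"
      using s(2) by (simp add: less_mult_imp_div_less mult.commute)
    from s(1) show "s \<in> f ` ?I \<union> g ` ?I"
    proof
      assume "s mod 52 \<in> R"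
      then have "s \<in> f ` ?I"
        using N by (intro image_eqI [of _ _ "(s mod 52, s div 52)"]) (auto simp: f_def)
      then show ?thesis ..
    next
      assume "s mod 52 \<in> (\<lambda>r. 52 - r) ` R"
      then obtain r where "r \<in> R" "s mod 52 = 52 - r"
        by blast
      moreover from this have "s = g (r, s div 52)"
        using mult_div_mod_eq [of 52 s] by (simp add: g_def)
      ultimately have "s \<in> g ` ?I"
        using N by blast
      then show ?thesis ..
    qed
  next
    fix s assume "s \<in> f ` ?I \<union> g ` ?I"
    then obtain r n where rn: "r \<in> R" "n < N" "s = f (r, n) \<or> s = g (r, n)"
      by auto
    have "s mod 52 = r \<or> s mod 52 = 52 - r"
      using rn f g by auto
    moreover have "s < 52 * N"
      using rn lt [OF rn(1)] by (auto simp: f_def g_def)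
    ultimately show "s \<in> {s. s \<in> pm_residues (int ` R) 52 \<and> s < 52 * N}"
      using rn(1) by (auto simp: pm_residues_iff [OF R])
  qed
  have pw: "z ^ (52 * n + k) = z ^ k * (z ^ 52) ^ n" for n k
    by (simp only: add.commute [of "52 * n" k] power_add power_mult)
  have "(\<Prod>s | s \<in> pm_residues (int ` R) 52 \<and> s < 52 * N. 1 - z ^ s) =
      (\<Prod>s\<in>f ` ?I. 1 - z ^ s) * (\<Prod>s\<in>g ` ?I. 1 - z ^ s)"
    unfolding eq using finite_R disj by (intro prod.union_disjoint) auto
  also have "(\<Prod>s\<in>f ` ?I. 1 - z ^ s) = (\<Prod>r\<in>R. \<Prod>n<N. 1 - z ^ r * (z ^ 52) ^ n)"
    unfolding prod.reindex [OF injf] prod.cartesian_product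
    by (intro prod.cong) (simp_all only: f_def case_prod_unfold o_def fst_conv snd_conv pw)
  also have "(\<Prod>s\<in>g ` ?I. 1 - z ^ s) = (\<Prod>r\<in>R. \<Prod>n<N. 1 - z ^ (52 - r) * (z ^ 52) ^ n)"
    unfolding prod.reindex [OF injg] prod.cartesian_product
    by (intro prod.cong) (simp_all only: g_def case_prod_unfold o_def fst_conv snd_conv pw)
  finally show ?thesis
    by (simp only: prod.distrib)
qed

lemma residue_partition_series:
  assumes z: "norm z < 1"
  shows "summable (\<lambda>n. real (num_partitions (pm_residues (int ` R) 52) n) * norm z ^ n)"
    and "(\<lambda>n. of_nat (num_partitions (pm_residues (int ` R) 52) n) * z ^ n) sums
      inverse (\<Prod>r\<in>R. residue_prod z r)"
proof -
  define S where "S = pm_residues (int ` R) 52"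
  define A where "A N = {s. s \<in> S \<and> s < 52 * N}" for N
  have S: "0 \<notin> S"
    unfolding S_def by (rule zero_notin_pm_residues)
  have fin: "finite (A N)" for N
    by (rule finite_subset [of _ "{..<52 * N}"]) (auto simp: A_def)
  have sub: "S \<inter> {..N} \<subseteq> A N" for N
  proof
    fix s assume s: "s \<in> S \<inter> {..N}"
    \<comment> \<open>For \<open>N = 0\<close> the set \<open>A N\<close> is empty; the inclusion
      survives because 0 is not a part.\<close>
    then have "s \<noteq> 0"
      using S by (intro notI) simp
    then show "s \<in> A N"
      using s by (simp add: A_def)
  qed
  have "A N \<subseteq> S" for N
    by (auto simp: A_def)
  have lim: "(\<lambda>N. \<Prod>s\<in>A N. 1 - w ^ s) \<longlonglongrightarrow> (\<Prod>r\<in>R. residue_prod w r)" if "norm w < 1" for w :: complex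
    unfolding A_def S_def prod_pm_residues residue_prod_def
    using that by (intro tendsto_prod tendsto_mult qpoch_LIMSEQ) (auto simp: norm_power power_less_one_iff)
  have nz: "(\<Prod>r\<in>R. residue_prod w r) \<noteq> 0" if w: "norm w < 1" for w
  proof -
    have "residue_prod w r \<noteq> 0" if "r \<in> R" for r
    proof (rule residue_prod_nonzero [OF w])
      show "0 < r" "r < 52"
        using R that by auto
    qed
    then show ?thesis
      by (simp add: finite_R)
  qed
  have z': "norm (complex_of_real (norm z)) < 1"
    using z by simp
  show "summable (\<lambda>n. real (num_partitions (pm_residues (int ` R) 52) n) * norm z ^ n)"
    and "(\<lambda>n. of_nat (num_partitions (pm_residues (int ` R) 52) n) * z ^ n) sums
      inverse (\<Prod>r\<in>R. residue_prod z r)"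
    using partition_series [OF S z fin sub \<open>\<And>N. A N \<subseteq> S\<close> lim [OF z] nz [OF z] lim [OF z'] nz [OF z']]
    unfolding S_def by blast+
qed

text \<open>The bridge between the modular and the combinatorial side: since 5408 = 104 * 52, the
  leading exponential is \<open>ee (t / 52)\<close> to the power
  \<open>cusp_order R 1 / 104\<close>, and the other factor is the partition series in that
  variable.\<close>

lemma modular_unit_1_0:
  "modular_unit R 1 0 t =
    ee (of_int (cusp_order R 1) * t / 5408) * inverse (\<Prod>r\<in>R. residue_prod (ee (t / 52)) r)"
proof -
  have kl: "klein (real r / 52) 0 t = ee (- (of_int (int r * (52 - int r)) * t / 5408)) * residue_prod (ee (t / 52)) r"
    if "r \<in> R" for r
  proof -
    have r: "r \<le> 52"
      using R that by auto
    have 1: "ee (t / 52) ^ r = ee (of_real (real r / 52) * t)" "ee (t / 52) ^ 52 = ee t"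
      by (simp_all add: ee_power)
    have 2: "ee (t / 52) ^ (52 - r) = ee (t - of_real (real r / 52) * t)"
      unfolding ee_power using r by (intro arg_cong [where f = ee]) (simp add: of_nat_diff field_simps)
    have 3: "ee (of_real (real r / 52) * (of_real (real r / 52) * t) / 2) * ee (- (of_real (real r / 52) * t) / 2) =
        ee (- (of_int (int r * (52 - int r)) * t / 5408))"
      unfolding ee_add [symmetric] by (rule arg_cong [where f = ee]) (simp add: field_simps)
    show ?thesis
      unfolding klein_def theta_def residue_prod_def 1 2 3 [symmetric] by simp
  qed
  have co: "cusp_order R 1 = (\<Sum>r\<in>R. int r * (52 - int r)) - 5408"
  proof -
    have "int r mod 52 = int r" if "r \<in> R" for r
    proof -
      have "r < 52"
        using R that by auto
      then show ?thesis
        by simp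
    qed
    then show ?thesis
      by (simp add: cusp_order_def)
  qed
  have "modular_unit R 1 0 t = inverse (ee t * (\<Prod>r\<in>R. klein (real r / 52) 0 t))"
    by (simp add: modular_unit_def)
  also have "(\<Prod>r\<in>R. klein (real r / 52) 0 t) =
      ee (\<Sum>r\<in>R. - (of_int (int r * (52 - int r)) * t / 5408)) * (\<Prod>r\<in>R. residue_prod (ee (t / 52)) r)"
    unfolding ee_sum prod.distrib [symmetric] by (intro prod.cong refl kl)
  also have "(\<Sum>r\<in>R. - (of_int (int r * (52 - int r)) * t / 5408)) = - (of_int (cusp_order R 1 + 5408) * t / 5408)"
    by (simp add: co sum_negf sum_distrib_right sum_divide_distrib)
  also have "inverse (ee t * (ee (- (of_int (cusp_order R 1 + 5408) * t / 5408)) * (\<Prod>r\<in>R. residue_prod (ee (t / 52)) r))) =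
      inverse (ee t * ee (- (of_int (cusp_order R 1 + 5408) * t / 5408))) * inverse (\<Prod>r\<in>R. residue_prod (ee (t / 52)) r)"
    by (simp only: inverse_mult_distrib mult.assoc)
  also have "inverse (ee t * ee (- (of_int (cusp_order R 1 + 5408) * t / 5408))) = ee (of_int (cusp_order R 1) * t / 5408)"
    unfolding ee_add [symmetric] ee_minus [symmetric] by (rule arg_cong [where f = ee]) (simp add: field_simps)
  finally show ?thesis .
qed

end

section \<open>Coefficients of the defect\<close>

text \<open>The coefficients of \<open>F(R) - z^k F(R') - z^i\<close>, where \<open>F\<close> is the partition generating function.\<close>

definition coeff_defect :: "nat set \<Rightarrow> nat set \<Rightarrow> nat \<Rightarrow> nat \<Rightarrow> nat \<Rightarrow> int" where
  "coeff_defect R R' k i n =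
     int (num_partitions (pm_residues (int ` R) 52) n) -
     (if k \<le> n then int (num_partitions (pm_residues (int ` R') 52) (n - k)) else 0) -
     (if n = i then 1 else 0)"

text \<open>By \<open>o\<close> and \<open>o'\<close> the two units begin with the powers
  \<open>- i\<close> and \<open>k - i\<close> of \<open>z\<close>. The factor \<open>z ^ i\<close>
  clears the pole and moves the constant 1 to index \<open>i\<close>; hence a single exceptional
  index, which is 4 in part (ii) and 0 in the others.\<close>

lemma coeff_defect_series:
  assumes R: "R \<subseteq> {1..25}" and R': "R' \<subseteq> {1..25}"
    and o: "cusp_order R 1 = - 104 * int i" and o': "cusp_order R' 1 = 104 * (int k - int i)"
    and t: "Im t > 0"
  defines "z \<equiv> ee (t / 52)"
  shows "(\<lambda>n. of_int (coeff_defect R R' k i n) * z ^ n) sums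
      (z ^ i * (modular_unit R 1 0 t - modular_unit R' 1 0 t - 1))"
    and "summable (\<lambda>n. \<bar>real_of_int (coeff_defect R R' k i n)\<bar> * norm z ^ n)"
proof -
  have z: "norm z < 1"
    unfolding z_def using t by (intro norm_ee_less_1) simp
  define F where "F = inverse (\<Prod>r\<in>R. residue_prod z r)"
  define F' where "F' = inverse (\<Prod>r\<in>R'. residue_prod z r)"
  note s = residue_partition_series [OF R z]
  note s' = residue_partition_series [OF R' z]
  have one: "(\<lambda>n. (if n = i then 1 else 0) * x ^ n) sums (x ^ i)" for x :: complex
    using sums_single [of i "\<lambda>n. x ^ n"] by (rule sums_cong [THEN iffD1, rotated]) auto
  have one': "(\<lambda>n. (if n = i then 1 else 0) * x ^ n) sums (x ^ i)" for x :: real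
    using sums_single [of i "\<lambda>n. x ^ n"] by (rule sums_cong [THEN iffD1, rotated]) auto
  have "z ^ i * modular_unit R 1 0 t = F"
  proof -
    have "z ^ i * ee (of_int (cusp_order R 1) * t / 5408) = ee 0"
      unfolding z_def ee_power ee_add [symmetric]
      by (rule arg_cong [where f = ee]) (simp add: o field_simps)
    then show ?thesis
      unfolding modular_unit_1_0 [OF R] F_def z_def by (simp add: mult.assoc [symmetric])
  qed
  moreover have "z ^ i * modular_unit R' 1 0 t = z ^ k * F'"
  proof -
    have "z ^ i * ee (of_int (cusp_order R' 1) * t / 5408) = z ^ k"
      unfolding z_def ee_power ee_add [symmetric]
      by (rule arg_cong [where f = ee]) (simp add: o' field_simps)
    then show ?thesis
      unfolding modular_unit_1_0 [OF R'] F'_def z_def by (simp add: mult.assoc [symmetric])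
  qed
  ultimately have eq: "z ^ i * (modular_unit R 1 0 t - modular_unit R' 1 0 t - 1) = F - z ^ k * F' - z ^ i"
    by (simp add: algebra_simps)
  have "(\<lambda>n. of_nat (num_partitions (pm_residues (int ` R) 52) n) * z ^ n -
      (if k \<le> n then of_nat (num_partitions (pm_residues (int ` R') 52) (n - k)) else 0) * z ^ n -
      (if n = i then 1 else 0) * z ^ n) sums (F - z ^ k * F' - z ^ i)"
    unfolding F_def F'_def by (intro sums_diff s(2) sums_shift s'(2) one)
  then show "(\<lambda>n. of_int (coeff_defect R R' k i n) * z ^ n) sums
      (z ^ i * (modular_unit R 1 0 t - modular_unit R' 1 0 t - 1))"
    unfolding eq coeff_defect_def
    by (rule sums_cong [THEN iffD1, rotated]) (auto simp: algebra_simps)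
  have "summable (\<lambda>n. real (num_partitions (pm_residues (int ` R) 52) n) * norm z ^ n +
      (if k \<le> n then real (num_partitions (pm_residues (int ` R') 52) (n - k)) else 0) * norm z ^ n +
      (if n = i then 1 else 0) * norm z ^ n)"
    by (intro summable_add s(1) sums_summable [OF sums_shift [OF summable_sums [OF s'(1)]]]
        sums_summable [OF one'])
  then show "summable (\<lambda>n. \<bar>real_of_int (coeff_defect R R' k i n)\<bar> * norm z ^ n)"
  proof (rule summable_comparison_test' [where N = 0])
    fix n
    have "\<bar>real_of_int (coeff_defect R R' k i n)\<bar> \<le> real (num_partitions (pm_residues (int ` R) 52) n) +
        (if k \<le> n then real (num_partitions (pm_residues (int ` R') 52) (n - k)) else 0) + (if n = i then 1 else 0)"
      by (auto simp: coeff_defect_def)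
    then have "\<bar>real_of_int (coeff_defect R R' k i n)\<bar> * norm z ^ n \<le>
        (real (num_partitions (pm_residues (int ` R) 52) n) +
        (if k \<le> n then real (num_partitions (pm_residues (int ` R') 52) (n - k)) else 0) + (if n = i then 1 else 0)) * norm z ^ n"
      by (rule mult_right_mono) simp
    moreover have nn: "norm (\<bar>real_of_int (coeff_defect R R' k i n)\<bar> * norm z ^ n) =
        \<bar>real_of_int (coeff_defect R R' k i n)\<bar> * norm z ^ n"
      by (simp add: abs_mult)
    ultimately show "norm (\<bar>real_of_int (coeff_defect R R' k i n)\<bar> * norm z ^ n) \<le>
        real (num_partitions (pm_residues (int ` R) 52) n) * norm z ^ n +
      (if k \<le> n then real (num_partitions (pm_residues (int ` R') 52) (n - k)) else 0) * norm z ^ n +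
      (if n = i then 1 else 0) * norm z ^ n"
      by (simp only: nn distrib_right)
  qed
qed

section \<open>Uniqueness of coefficients on the punctured disc\<close>

lemma power_series_eq_0:
  fixes c :: "nat \<Rightarrow> complex"
  assumes "\<And>z. z \<noteq> 0 \<Longrightarrow> norm z < 1 \<Longrightarrow> (\<lambda>n. c n * z ^ n) sums 0"
  shows "c m = 0"
proof (rule ccontr)
  assume m: "c m \<noteq> 0"
  \<comment> \<open>The hypothesis leaves out \<open>z = 0\<close>, which corresponds to the cusp.
    Multiplying the series by \<open>z\<close> makes it vanish there as well and gives the nonzero
    coefficient a positive index, as the isolation of zeros demands.\<close>
  define a where "a n = (case n of 0 \<Rightarrow> 0 | Suc n \<Rightarrow> c n)" for n
  have series: "(\<lambda>n. a n * (z - 0) ^ n) sums 0" if "norm (z - 0) < 1" for z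
  proof (cases "z = 0")
    case True
    have "a n * 0 ^ n = 0" for n
      by (cases n) (auto simp: a_def)
    then show ?thesis
      using True by (simp only: diff_zero sums_zero)
  next
    case False
    then have "(\<lambda>n. z * (c n * z ^ n)) sums (z * 0)"
      using assms that by (intro sums_mult) auto
    then have "(\<lambda>n. a (Suc n) * z ^ Suc n) sums 0"
      by (simp add: a_def mult_ac)
    then have "(\<lambda>n. a n * z ^ n) sums (0 + a 0 * z ^ 0)"
      by (rule sums_Suc [of "\<lambda>n. a n * z ^ n"])
    then show ?thesis
      by (simp add: a_def)
  qed
  have am: "a (Suc m) \<noteq> 0"
    using m by (simp add: a_def)
  show False
  proof (rule powser_0_nonzero [OF zero_less_one series refl am zero_less_Suc])
    fix s :: real
    assume s: "0 < s" "\<And>z :: complex. z \<in> cball 0 s - {0} \<Longrightarrow> (0 :: complex) \<noteq> 0"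
    have "complex_of_real s \<in> cball 0 s - {0}"
      using s(1) by simp
    from s(2) [OF this] show False
      by simp
  qed
qed

lemma ex_ee_eq:
  assumes "z \<noteq> 0" "norm z < 1"
  obtains t where "Im t > 0" "ee (t / 52) = z"
proof -
  define t where "t = 52 * Ln z / (2 * of_real pi * \<i>)"
  have "ee (t / 52) = exp (Ln z)"
    by (simp add: ee_def t_def)
  then have ee: "ee (t / 52) = z"
    using assms by simp
  have "exp (- (2 * pi * Im (t / 52))) < 1"
    using assms(2) unfolding ee [symmetric] norm_ee .
  then have "Im t > 0"
    by (simp add: zero_less_mult_iff)
  then show ?thesis
    using that ee by blast
qed

lemma coeff_defect_eq_0:
  assumes R: "R \<subseteq> {1..25}" and R': "R' \<subseteq> {1..25}"
    and o: "cusp_order R 1 = - 104 * int i" and o': "cusp_order R' 1 = 104 * (int k - int i)"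
    and eq: "\<And>t. Im t > 0 \<Longrightarrow> modular_unit R 1 0 t - modular_unit R' 1 0 t = 1"
  shows "coeff_defect R R' k i n = 0"
proof -
  have "of_int (coeff_defect R R' k i n) = (0 :: complex)"
  proof (rule power_series_eq_0)
    fix z :: complex assume "z \<noteq> 0" "norm z < 1"
    then obtain t where t: "Im t > 0" "ee (t / 52) = z"
      using ex_ee_eq by blast
    show "(\<lambda>n. of_int (coeff_defect R R' k i n) * z ^ n) sums 0"
      using coeff_defect_series(1) [OF R R' o o' t(1)] eq [OF t(1)] by (simp add: t(2))
  qed
  then show ?thesis
    by simp
qed

text \<open>Division of a truncated power series by \<open>1 - X^s\<close>; the list is accumulated in reverse.\<close>

definition add_part :: "int list \<Rightarrow> nat \<Rightarrow> int list" where
  "add_part xs s = rev (foldl (\<lambda>acc x. (x + (if s \<le> length acc then acc ! (s - 1) else 0)) # acc) [] xs)"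

lemma add_part_correct:
  fixes f g :: "nat \<Rightarrow> int"
  assumes s: "s > 0" and rec: "\<And>n. g n = f n + (if s \<le> n then g (n - s) else 0)"
  shows "add_part (map f [0..<n]) s = map g [0..<n]"
proof -
  have "foldl (\<lambda>acc x. (x + (if s \<le> length acc then acc ! (s - 1) else 0)) # acc) [] (map f [0..<n]) =
      rev (map g [0..<n])"
  proof (induction n)
    case (Suc n)
    have "rev (map g [0..<n]) ! (s - 1) = g (n - s)" if "s \<le> n"
      using s that by (simp add: rev_nth)
    then have "f n + (if s \<le> n then rev (map g [0..<n]) ! (s - 1) else 0) = g n"
      using rec [of n] by simp
    then show ?case
      using Suc by simp
  qed simp
  then show ?thesis
    by (simp add: add_part_def)
qed

text \<open>\<open>num_partitions\<close> is the cardinality of a set of multisets and is not suited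
  to evaluation; dividing by one factor per part makes it a computation with lists.\<close>

lemma foldl_add_part:
  assumes "distinct ss" "0 \<notin> set ss"
  shows "foldl add_part (map (\<lambda>n. if n = 0 then 1 else 0) [0..<N]) ss =
    map (\<lambda>n. int (num_partitions (set ss) n)) [0..<N]"
  using assms
proof (induction ss rule: rev_induct)
  case Nil
  then show ?case by (simp add: num_partitions_empty)
next
  case (snoc s ss)
  have "foldl add_part (map (\<lambda>n. if n = 0 then 1 else 0) [0..<N]) (ss @ [s]) =
      add_part (map (\<lambda>n. int (num_partitions (set ss) n)) [0..<N]) s"
    using snoc by simp
  also have "\<dots> = map (\<lambda>n. int (num_partitions (insert s (set ss)) n)) [0..<N]"
    using snoc.prems num_partitions_insert [of "set ss" s]
    by (intro add_part_correct) (auto intro: gr0I)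
  finally show ?case
    by simp
qed

text \<open>Up to \<open>n = 52\<close> only the first period of parts matters: 52 itself is no
  part, and later parts are at least 53. This is exactly the range of the 53 coefficients that are
  checked.\<close>

lemma num_partitions_truncate:
  assumes R: "R \<subseteq> {1..25}" and "n \<le> 52"
  shows "num_partitions (pm_residues (int ` R) 52) n = num_partitions (R \<union> (\<lambda>r. 52 - r) ` R) n"
proof (rule num_partitions_cong [symmetric])
  have "s \<in> pm_residues (int ` R) 52" if "s \<in> R \<union> (\<lambda>r. 52 - r) ` R" for s
  proof -
    have "s < 52"
      using that R by auto
    then show ?thesis
      using that by (auto simp: pm_residues_iff [OF R])
  qed
  then show "R \<union> (\<lambda>r. 52 - r) ` R \<subseteq> pm_residues (int ` R) 52"
    by blast
  show "pm_residues (int ` R) 52 \<inter> {..n} \<subseteq> R \<union> (\<lambda>r. 52 - r) ` R"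
  proof
    fix s assume s: "s \<in> pm_residues (int ` R) 52 \<inter> {..n}"
    then have "s mod 52 \<in> R \<or> s mod 52 \<in> (\<lambda>r. 52 - r) ` R" "s \<le> 52"
      using assms(2) by (auto simp: pm_residues_iff [OF R])
    moreover from this have "s \<noteq> 52"
      using R by auto
    ultimately show "s \<in> R \<union> (\<lambda>r. 52 - r) ` R"
      by auto
  qed
qed

lemma initial_coeffs:
  assumes "n < 53"
  shows "coeff_defect S52 T52 1 0 n = 0"
proof -
  define ss :: "nat list" where
    "ss = [1, 3, 4, 5, 7, 16, 18, 19, 21, 22, 23, 25, 51, 49, 48, 47, 45, 36, 34, 33, 31, 30, 29, 27]"
  define ts :: "nat list" where
    "ts = [1, 2, 3, 7, 11, 15, 18, 19, 20, 23, 24, 25, 51, 50, 49, 45, 41, 37, 34, 33, 32, 29, 28, 27]"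
  have ss: "set ss = S52 \<union> (\<lambda>r. 52 - r) ` S52" "distinct ss" "0 \<notin> set ss"
    by (auto simp: ss_def)
  have ts: "set ts = T52 \<union> (\<lambda>r. 52 - r) ` T52" "distinct ts" "0 \<notin> set ts"
    by (auto simp: ts_def)
  \<comment> \<open>Prepending 1 and dropping the last entry yields \<open>1 + q * F(T)\<close>,
    truncated to the same length.\<close>
  have "foldl add_part (map (\<lambda>n. if n = 0 then 1 else 0) [0..<53]) ss =
      1 # butlast (foldl add_part (map (\<lambda>n. if n = 0 then 1 else 0) [0..<53]) ts)"
    unfolding ss_def ts_def by code_simp
  then have "map (\<lambda>n. int (num_partitions (set ss) n)) [0..<53] =
      1 # butlast (map (\<lambda>n. int (num_partitions (set ts) n)) [0..<53])"
    unfolding foldl_add_part [OF ss(2,3)] foldl_add_part [OF ts(2,3)] .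
  then have "map (\<lambda>n. int (num_partitions (set ss) n)) [0..<53] ! n =
      (1 # butlast (map (\<lambda>n. int (num_partitions (set ts) n)) [0..<53])) ! n"
    by simp
  then have "int (num_partitions (set ss) n) = (if n = 0 then 1 else int (num_partitions (set ts) (n - 1)))"
    using assms by (cases n) (simp_all add: nth_butlast)
  moreover have "num_partitions (pm_residues (int ` S52) 52) n = num_partitions (set ss) n"
    unfolding ss(1) using assms by (intro num_partitions_truncate) auto
  moreover have "num_partitions (pm_residues (int ` T52) 52) (n - 1) = num_partitions (set ts) (n - 1)"
    unfolding ts(1) using assms by (intro num_partitions_truncate) auto
  ultimately show ?thesis
    by (simp add: coeff_defect_def)
qed

section \<open>Vanishing of the defect\<close>

lemma norm_defect_1_0_le:
  obtains K where "\<And>t. Im t \<ge> 1/2 \<Longrightarrow> norm (defect 1 0 t) \<le> K * exp (- (2 * pi * Im t * 53 / 52))"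
proof -
  have R: "S52 \<subseteq> {1..25}" "T52 \<subseteq> {1..25}"
    by auto
  have o: "cusp_order S52 1 = - 104 * int 0" "cusp_order T52 1 = 104 * (int 1 - int 0)"
    by (simp_all add: cusp_order_def)
  define d where "d = coeff_defect S52 T52 1 0"
  \<comment> \<open>The modulus of \<open>z\<close> on the line \<open>Im t = 1/2\<close>, the
    largest in the region considered.\<close>
  define rho where "rho = exp (- pi / 52)"
  define D where "D = (\<Sum>n. \<bar>real_of_int (d n)\<bar> * rho ^ n)"
  have rho: "rho > 0" "norm (ee (\<i> / 2 / 52)) = rho"
    by (simp_all add: rho_def norm_ee)
  have "summable (\<lambda>n. \<bar>real_of_int (d n)\<bar> * norm (ee (\<i> / 2 / 52)) ^ n)"
    unfolding d_def by (rule coeff_defect_series [OF R o]) simp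
  then have sumD: "summable (\<lambda>n. \<bar>real_of_int (d n)\<bar> * rho ^ n)"
    unfolding rho(2) .
  have "norm (defect 1 0 t) \<le> (D / rho ^ 53) * exp (- (2 * pi * Im t * 53 / 52))" if t: "Im t \<ge> 1/2" for t
  proof -
    define z where "z = ee (t / 52)"
    have nz: "norm z = exp (- (2 * pi * Im t / 52))"
      by (simp add: z_def norm_ee)
    have le: "norm z \<le> rho"
    proof -
      have "pi * 1 \<le> pi * (2 * Im t)"
        using t by (intro mult_left_mono) auto
      then show ?thesis
        by (simp add: nz rho_def)
    qed
    have t0: "Im t > 0"
      using t by simp
    have sums: "(\<lambda>n. of_int (d n) * z ^ n) sums defect 1 0 t"
      using coeff_defect_series(1) [OF R o t0] unfolding d_def z_def defect_def power_0 mult_1 .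
    have sm: "summable (\<lambda>n. \<bar>real_of_int (d n)\<bar> * norm z ^ n)"
      using coeff_defect_series(2) [OF R o t0] unfolding d_def z_def .
    have "norm (defect 1 0 t) = norm (\<Sum>n. of_int (d n) * z ^ n)"
      using sums by (simp add: sums_iff)
    also have "\<dots> \<le> (\<Sum>n. norm (of_int (d n) * z ^ n))"
      using sm by (intro summable_norm) (simp add: norm_mult norm_power)
    also have "\<dots> = (\<Sum>n. \<bar>real_of_int (d n)\<bar> * norm z ^ n)"
      by (simp add: norm_mult norm_power)
    \<comment> \<open>The terms with \<open>n < 53\<close> vanish; in the others 53 factors
      \<open>norm z / rho\<close> are split off, and the remaining such factors are at most
      1.\<close>
    also have "\<dots> \<le> (\<Sum>n. (norm z / rho) ^ 53 * (\<bar>real_of_int (d n)\<bar> * rho ^ n))"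
    proof (rule suminf_le)
      fix n
      show "\<bar>real_of_int (d n)\<bar> * norm z ^ n \<le> (norm z / rho) ^ 53 * (\<bar>real_of_int (d n)\<bar> * rho ^ n)"
      proof (cases "n < 53")
        case True
        then show ?thesis
          using initial_coeffs [of n] by (simp add: d_def)
      next
        case False
        then obtain m where n: "n = 53 + m"
          using le_Suc_ex [of 53 n] by auto
        have "norm z ^ m \<le> rho ^ m"
          using le by (intro power_mono) auto
        then have "\<bar>real_of_int (d n)\<bar> * norm z ^ 53 * norm z ^ m \<le> \<bar>real_of_int (d n)\<bar> * norm z ^ 53 * rho ^ m"
          by (intro mult_left_mono) auto
        then show ?thesis
          using rho(1) by (simp add: n power_add power_divide field_simps)
      qed
    qed (use sm sumD in \<open>auto intro: summable_mult\<close>)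
    also have "\<dots> = (norm z / rho) ^ 53 * D"
      unfolding D_def by (rule suminf_mult [OF sumD])
    also have "norm z ^ 53 = exp (- (2 * pi * Im t * 53 / 52))"
      unfolding nz exp_of_nat_mult [symmetric] by simp
    then have "(norm z / rho) ^ 53 * D = (D / rho ^ 53) * exp (- (2 * pi * Im t * 53 / 52))"
      by (simp only: power_divide) simp
    finally show ?thesis .
  qed
  then show ?thesis
    using that by blast
qed

lemma norm_defect_le:
  assumes ab: "(a, b) \<in> primitive_pairs"
  shows "\<exists>K. \<forall>t. Im t \<ge> 1/2 \<longrightarrow> norm (defect a b t) \<le> K * exp (- (2 * pi * Im t * of_int (min_order a) / 5408))"
proof (cases "a = 1")
  case True
  obtain K where K: "\<And>t. Im t \<ge> 1/2 \<Longrightarrow> norm (defect 1 0 t) \<le> K * exp (- (2 * pi * Im t * 53 / 52))"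
    using norm_defect_1_0_le by blast
  \<comment> \<open>A translation by \<open>b\<close> relates \<open>(1, b)\<close> to
    \<open>(1, 0)\<close> without changing \<open>Im t\<close>, and 5512 / 5408 = 53 / 52.\<close>
  have "norm (defect a b t) \<le> K * exp (- (2 * pi * Im t * of_int (min_order a) / 5408))" if "Im t \<ge> 1/2" for t
    using K [of "t + of_int b"] that True by (simp add: defect_add_of_int min_order_def)
  then show ?thesis
    by blast
next
  case False
  have a: "a \<ge> 0" and prim: "primitive a b"
    using ab by (auto simp: primitive_pairs_def)
  have fin: "finite S52" "finite T52"
    by auto
  obtain K where K: "K > 0"
    "\<And>t. Im t \<ge> 1/2 \<Longrightarrow> norm (modular_unit S52 a b t) \<le> K * exp (- (2 * pi * Im t * of_int (cusp_order S52 a) / 5408))"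
  proof (rule norm_modular_unit_le [OF fin(1) a, of b])
    show "\<not> (52 dvd int r * a \<and> 52 dvd int r * b)" if "r \<in> S52" for r
      using that by (intro primitive_not_dvd prim) auto
  qed blast
  obtain K' where K': "K' > 0"
    "\<And>t. Im t \<ge> 1/2 \<Longrightarrow> norm (modular_unit T52 a b t) \<le> K' * exp (- (2 * pi * Im t * of_int (cusp_order T52 a) / 5408))"
  proof (rule norm_modular_unit_le [OF fin(2) a, of b])
    show "\<not> (52 dvd int r * a \<and> 52 dvd int r * b)" if "r \<in> T52" for r
      using that by (intro primitive_not_dvd prim) auto
  qed blast
  \<comment> \<open>The cap at 0 is what absorbs the constant 1 of the defect.\<close>
  have M: "min_order a \<le> cusp_order S52 a" "min_order a \<le> cusp_order T52 a" "min_order a \<le> 0"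
    using False by (simp_all add: min_order_def)
  have "norm (defect a b t) \<le> (K + K' + 1) * exp (- (2 * pi * Im t * of_int (min_order a) / 5408))"
    if t: "Im t \<ge> 1/2" for t
  proof -
    have mono: "exp (- (2 * pi * Im t * of_int n / 5408)) \<le> exp (- (2 * pi * Im t * of_int (min_order a) / 5408))"
      if "min_order a \<le> n" for n
    proof -
      have "2 * pi * Im t * of_int (min_order a) \<le> 2 * pi * Im t * of_int n"
        using that t by (intro mult_left_mono) auto
      then show ?thesis
        by simp
    qed
    have "norm (defect a b t) \<le> norm (modular_unit S52 a b t) + norm (modular_unit T52 a b t) + 1"
      using norm_triangle_ineq4 [of "modular_unit S52 a b t - modular_unit T52 a b t" 1]
        norm_triangle_ineq4 [of "modular_unit S52 a b t" "modular_unit T52 a b t"]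
      unfolding defect_def norm_one by linarith
    also have "\<dots> \<le> K * exp (- (2 * pi * Im t * of_int (min_order a) / 5408)) +
        K' * exp (- (2 * pi * Im t * of_int (min_order a) / 5408)) + exp (- (2 * pi * Im t * of_int (min_order a) / 5408))"
    proof (intro add_mono)
      show "norm (modular_unit S52 a b t) \<le> K * exp (- (2 * pi * Im t * of_int (min_order a) / 5408))"
        using K(2) [OF t] by (rule order_trans) (intro mult_left_mono mono M less_imp_le [OF K(1)])
      show "norm (modular_unit T52 a b t) \<le> K' * exp (- (2 * pi * Im t * of_int (min_order a) / 5408))"
        using K'(2) [OF t] by (rule order_trans) (intro mult_left_mono mono M less_imp_le [OF K'(1)])
      show "1 \<le> exp (- (2 * pi * Im t * of_int (min_order a) / 5408))"
        using mono [OF M(3)] by simp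
    qed
    finally show ?thesis
      by (simp add: algebra_simps)
  qed
  then show ?thesis
    by blast
qed

lemma primitive_mod:
  "primitive (a mod 52) b \<longleftrightarrow> primitive a b" "primitive a (b mod 52) \<longleftrightarrow> primitive a b"
  by (simp_all add: primitive_def dvd_mod_iff)

text \<open>Translation and inversion act on the indices by \<open>(a, a + b)\<close> and
  \<open>(b, - a)\<close>, which permute the primitive pairs modulo 52. The decay rates of the
  factors add up, so the sign of the total order is all that matters.\<close>

lemma prod_defect_eq_0:
  assumes "Im t > 0"
  shows "(\<Prod>(a, b)\<in>primitive_pairs. defect a b t) = 0"
proof -
  define P where "P t = (\<Prod>(a, b)\<in>primitive_pairs. defect a b t)" for t
  define M where "M = (\<Sum>(a, b)\<in>primitive_pairs. min_order a)"
  have "\<forall>(a, b)\<in>primitive_pairs. \<exists>K. \<forall>t. Im t \<ge> 1/2 \<longrightarrow>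
      norm (defect a b t) \<le> K * exp (- (2 * pi * Im t * of_int (min_order a) / 5408))"
    using norm_defect_le by blast
  then obtain K where K: "\<And>a b t. (a, b) \<in> primitive_pairs \<Longrightarrow> Im t \<ge> 1/2 \<Longrightarrow>
      norm (defect a b t) \<le> K (a, b) * exp (- (2 * pi * Im t * of_int (min_order a) / 5408))"
    unfolding case_prod_unfold by (metis fst_conv snd_conv)
  have "P t = 0"
  proof (rule modular_function_vanishes [of P])
    have "(\<lambda>t. \<Prod>x\<in>primitive_pairs. defect (fst x) (snd x) t) holomorphic_on {t. Im t > 0}"
      by (intro holomorphic_on_prod holomorphic_defect) (auto simp: primitive_pairs_def)
    then show "P holomorphic_on {t. Im t > 0}"
      by (simp add: P_def [abs_def] case_prod_unfold)
    show "P (t + 1) = P t" if t: "Im t > 0" for t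
      unfolding P_def
    proof (rule prod.reindex_bij_witness [of _ "\<lambda>(a, b). (a, (b - a) mod 52)" "\<lambda>(a, b). (a, (a + b) mod 52)"])
      fix x assume x: "x \<in> primitive_pairs"
      obtain a b where ab: "x = (a, b)"
        by fastforce
      have "primitive a (b - a)" "primitive a (a + b)"
        using x by (auto simp: primitive_pairs_def primitive_def ab dvd_add_right_iff dvd_diff_left_iff)
      then show "(case x of (a, b) \<Rightarrow> (a, (a + b) mod 52)) \<in> primitive_pairs"
        "(case x of (a, b) \<Rightarrow> (a, (b - a) mod 52)) \<in> primitive_pairs"
        using x by (auto simp: primitive_pairs_def primitive_mod ab)
      show "(case case x of (a, b) \<Rightarrow> (a, (a + b) mod 52) of (a, b) \<Rightarrow> (a, (b - a) mod 52)) = x"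
        "(case case x of (a, b) \<Rightarrow> (a, (b - a) mod 52) of (a, b) \<Rightarrow> (a, (a + b) mod 52)) = x"
        using x by (auto simp: primitive_pairs_def ab mod_simps)
      show "(case case x of (a, b) \<Rightarrow> (a, (a + b) mod 52) of (a, b) \<Rightarrow> defect a b t) = (case x of (a, b) \<Rightarrow> defect a b (t + 1))"
        unfolding ab prod.case defect_translation using t by (intro defect_cong) (auto simp: unique_euclidean_semiring_class.cong_def)
    qed
    show "P (- 1 / t) = P t" if t: "Im t > 0" for t
      unfolding P_def
    proof (rule prod.reindex_bij_witness [of _ "\<lambda>(a, b). ((- b) mod 52, a)" "\<lambda>(a, b). (b, (- a) mod 52)"])
      fix x assume x: "x \<in> primitive_pairs"
      obtain a b where ab: "x = (a, b)"
        by fastforce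
      have "primitive (- b) a" "primitive b (- a)"
        using x by (auto simp: primitive_pairs_def primitive_def ab)
      then show "(case x of (a, b) \<Rightarrow> ((- b) mod 52, a)) \<in> primitive_pairs"
        "(case x of (a, b) \<Rightarrow> (b, (- a) mod 52)) \<in> primitive_pairs"
        using x by (auto simp: primitive_pairs_def primitive_mod ab)
      show "(case case x of (a, b) \<Rightarrow> (b, (- a) mod 52) of (a, b) \<Rightarrow> ((- b) mod 52, a)) = x"
        "(case case x of (a, b) \<Rightarrow> ((- b) mod 52, a) of (a, b) \<Rightarrow> (b, (- a) mod 52)) = x"
        using x by (auto simp: primitive_pairs_def ab mod_simps)
      have "defect b (- a) t = defect (- (- a)) b (- 1 / t)"
        using defect_inversion [OF t] by metis
      then show "(case case x of (a, b) \<Rightarrow> (b, (- a) mod 52) of (a, b) \<Rightarrow> defect a b t) = (case x of (a, b) \<Rightarrow> defect a b (- 1 / t))"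
        using defect_cong [OF t, of b b "- a mod 52" "- a"]
        by (simp add: ab unique_euclidean_semiring_class.cong_def)
    qed
    have "M > 0"
      unfolding M_def by (rule sum_min_order)
    then show "0 < 2 * pi * of_int M / 5408"
      by simp
    show "norm (P t) \<le> (\<Prod>x\<in>primitive_pairs. K x) * exp (- (2 * pi * of_int M / 5408 * Im t))" if t: "Im t \<ge> 1/2" for t
    proof -
      have "norm (P t) = (\<Prod>x\<in>primitive_pairs. norm (defect (fst x) (snd x) t))"
        by (simp add: P_def case_prod_unfold prod_norm)
      also have "\<dots> \<le> (\<Prod>x\<in>primitive_pairs. K x * exp (- (2 * pi * Im t * of_int (min_order (fst x)) / 5408)))"
        using K t by (intro prod_mono) auto
      also have "\<dots> = (\<Prod>x\<in>primitive_pairs. K x) *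
          exp (\<Sum>x\<in>primitive_pairs. - (2 * pi * Im t * of_int (min_order (fst x)) / 5408))"
        by (simp add: prod.distrib exp_sum finite_primitive_pairs)
      also have "(\<Sum>x\<in>primitive_pairs. - (2 * pi * Im t * of_int (min_order (fst x)) / 5408)) =
          - (2 * pi * of_int M / 5408 * Im t)"
        by (simp add: M_def case_prod_unfold sum_negf sum_distrib_left sum_divide_distrib mult_ac)
      finally show ?thesis .
    qed
  qed (use assms in simp)
  then show ?thesis
    by (simp add: P_def)
qed

lemma defect_eq_0:
  assumes "odd m" "\<not> 13 dvd m" "Im t > 0"
  shows "defect m 0 t = 0"
proof -
  have "\<exists>x\<in>primitive_pairs. \<forall>t\<in>{t. Im t > 0}. defect (fst x) (snd x) t = 0"
  proof (rule holomorphic_prod_eq_0)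
    show "connected {t. Im t > 0}"
      by (intro convex_connected convex_halfspace_Im_gt)
    show "{t. Im t > 0} \<noteq> {}"
      using assms(3) by blast
    show "defect (fst x) (snd x) holomorphic_on {t. Im t > 0}" if "x \<in> primitive_pairs" for x
      using that by (intro holomorphic_defect) (auto simp: primitive_pairs_def)
    show "(\<Prod>x\<in>primitive_pairs. defect (fst x) (snd x) t) = 0" if "t \<in> {t. Im t > 0}" for t
      using prod_defect_eq_0 [of t] that by (simp add: case_prod_unfold)
  qed (simp_all add: finite_primitive_pairs open_halfspace_Im)
  then obtain a b where ab: "(a, b) \<in> primitive_pairs" "\<And>t. Im t > 0 \<Longrightarrow> defect a b t = 0"
    by auto
  then have "primitive a b"
    by (simp add: primitive_pairs_def)
  then show ?thesis
    using ab(2) assms by (rule defect_vanishing_transitive)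
qed

text \<open>For \<open>y = 0\<close> an integer shift costs only a sign. The reflection of
  \<open>x\<close> to \<open>1 - x\<close> costs none, as the signs from oddness and from the shift
  cancel. So every multiple \<open>r * m\<close> folds back to an index of at most 26.\<close>

lemma klein_reduce:
  assumes t: "Im t > 0"
  shows "klein (real n / 52) 0 t = (- 1) ^ (n div 52) * klein (real (min (n mod 52) (52 - n mod 52)) / 52) 0 t"
proof -
  have "real (n mod 52 + 52 * (n div 52)) = real (n mod 52) + 52 * real (n div 52)"
    by (simp only: of_nat_add of_nat_mult of_nat_numeral)
  then have n: "real n = real (n mod 52) + 52 * real (n div 52)"
    by (simp only: mod_mult_div_eq)
  have n': "real n / 52 = real (n mod 52) / 52 + of_nat (n div 52)"
    by (subst n) (simp add: add_divide_distrib)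
  have 1: "klein (real n / 52) 0 t = (- 1) ^ (n div 52) * klein (real (n mod 52) / 52) 0 t"
    unfolding n' using klein_add_nat_left [OF t, of "real (n mod 52) / 52" "n div 52" 0] by simp
  have 2: "klein (real (52 - m) / 52) 0 t = klein (real m / 52) 0 t" if "m \<le> 52" for m
  proof -
    have m: "real (52 - m) / 52 = - (real m / 52) + 1"
      using that by (simp add: of_nat_diff field_simps)
    show ?thesis
      unfolding m using klein_add_1_left [OF t, of "- (real m / 52)" 0] klein_minus [OF t, of "real m / 52" 0] by simp
  qed
  have "klein (real (min (n mod 52) (52 - n mod 52)) / 52) 0 t = klein (real (n mod 52) / 52) 0 t"
    using 2 [of "n mod 52"] by (simp add: min_def)
  then show ?thesis
    using 1 by simp
qed

text \<open>The assumption \<open>red\<close> carries two functions \<open>f\<close>, \<open>g\<close> (both instantiated with the same one) only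
  to make its premise a terminating rewrite rule.\<close>

lemma partition_identity:
  assumes m: "odd m" "\<not> 13 dvd m"
    and R: "R \<subseteq> {1..25}" and R': "R' \<subseteq> {1..25}"
    and o: "cusp_order R 1 = - 104 * int i" "cusp_order R' 1 = 104 * (int k - int i)"
    and red: "\<And>f g. (\<And>n. f n = (- 1) ^ (n div 52) * g (min (n mod 52) (52 - n mod 52))) \<Longrightarrow>
        (\<Prod>r\<in>S52. f (r * m)) = (\<Prod>r\<in>R. g r :: complex) \<and> (\<Prod>r\<in>T52. f (r * m)) = (\<Prod>r\<in>R'. g r) \<or>
        (\<Prod>r\<in>S52. f (r * m)) = - (\<Prod>r\<in>R'. g r) \<and> (\<Prod>r\<in>T52. f (r * m)) = - (\<Prod>r\<in>R. g r)"
  shows "int (num_partitions (pm_residues (int ` R) 52) n) =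
     (if k \<le> n then int (num_partitions (pm_residues (int ` R') 52) (n - k)) else 0) + (if n = i then 1 else 0)"
proof -
  have "modular_unit R 1 0 t - modular_unit R' 1 0 t = 1" if t: "Im t > 0" for t
  proof -
    define f where "f n = klein (real n / 52) 0 t" for n
    have u: "modular_unit A (int l) 0 t = inverse (ee t * (\<Prod>r\<in>A. f (r * l)))" for A l
      by (simp add: modular_unit_def f_def)
    have u1: "modular_unit A 1 0 t = inverse (ee t * (\<Prod>r\<in>A. f r))" for A
      by (simp add: modular_unit_def f_def)
    have "f n = (- 1) ^ (n div 52) * f (min (n mod 52) (52 - n mod 52))" for n
      unfolding f_def using t by (rule klein_reduce)
    note cases = red [OF this]
    have eq: "modular_unit S52 (int m) 0 t - modular_unit T52 (int m) 0 t - 1 = 0"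
    proof -
      have "odd (int m)" "\<not> 13 dvd int m"
        using m int_dvd_int_iff [of 13 m] by auto
      then show ?thesis
        using defect_eq_0 t unfolding defect_def by blast
    qed
    from cases show ?thesis
    proof (elim disjE conjE)
      assume *: "(\<Prod>r\<in>S52. f (r * m)) = (\<Prod>r\<in>R. f r)" "(\<Prod>r\<in>T52. f (r * m)) = (\<Prod>r\<in>R'. f r)"
      show ?thesis
        using eq unfolding u u1 * by (simp add: algebra_simps)
    next
      \<comment> \<open>The two sets are exchanged and both units change sign, so the difference is
        again that of \<open>R\<close> and \<open>R'\<close> in this order.\<close>
      assume *: "(\<Prod>r\<in>S52. f (r * m)) = - (\<Prod>r\<in>R'. f r)" "(\<Prod>r\<in>T52. f (r * m)) = - (\<Prod>r\<in>R. f r)"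
      show ?thesis
        using eq unfolding u u1 * by (simp add: algebra_simps)
    qed
  qed
  then have "coeff_defect R R' k i n = 0"
    by (intro coeff_defect_eq_0 R R' o)
  then show ?thesis
    by (simp add: coeff_defect_def)
qed

theorem theorem9p1:
  shows "(let S = pm_residues {1, 3, 4, 5, 7, 16, 18, 19, 21, 22, 23, 25} 52;
          T = pm_residues {1, 2, 3, 7, 11, 15, 18, 19, 20, 23, 24, 25} 52
      in \<forall>n::nat. n \<ge> 1 \<longrightarrow> num_partitions S n = num_partitions T (n - 1)) \<and>
     (let S = pm_residues {2, 3, 4, 5, 9, 11, 12, 14, 15, 17, 21, 23} 52;
          T = pm_residues {2, 3, 5, 6, 7, 8, 9, 17, 19, 20, 21, 23} 52
      in \<forall>n::nat. n \<noteq> 4 \<longrightarrow> num_partitions S n = num_partitions T n) \<and>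
     (let S = pm_residues {3, 4, 5, 9, 10, 11, 14, 15, 16, 17, 21, 23} 52;
          T = pm_residues {1, 5, 6, 9, 11, 14, 15, 17, 20, 21, 24, 25} 52
      in \<forall>n::nat. n \<ge> 3 \<longrightarrow> num_partitions S n = num_partitions T (n - 3)) \<and>
     (let S = pm_residues {2, 3, 5, 7, 8, 9, 17, 19, 21, 22, 23, 24} 52;
          T = pm_residues {1, 3, 5, 7, 12, 14, 16, 19, 21, 22, 23, 25} 52
      in \<forall>n::nat. n \<ge> 2 \<longrightarrow> num_partitions S n = num_partitions T (n - 2)) \<and>
     (let S = pm_residues {1, 6, 7, 9, 10, 11, 12, 15, 16, 17, 19, 25} 52;
          T = pm_residues {1, 5, 6, 8, 9, 11, 15, 17, 18, 21, 24, 25} 52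
      in \<forall>n::nat. n \<ge> 1 \<longrightarrow> num_partitions S n = num_partitions T (n - 1)) \<and>
     (let S = pm_residues {1, 4, 7, 9, 10, 11, 12, 15, 17, 19, 22, 25} 52;
          T = pm_residues {1, 3, 7, 8, 10, 11, 15, 18, 19, 20, 23, 25} 52
      in \<forall>n::nat. n \<ge> 1 \<longrightarrow> num_partitions S n = num_partitions T (n - 1))"
proof -
  \<comment> \<open>Residues are written as images under \<open>int\<close>, and \<open>k\<close>
    and \<open>i\<close> appear explicitly, so that \<open>partition_identity\<close> applies by
    unification; simplification then multiplies the residues by \<open>m\<close>, folds them and
    compares signs.\<close>
  have p1: "int (num_partitions (pm_residues (int ` {1, 3, 4, 5, 7, 16, 18, 19, 21, 22, 23, 25}) 52) n) =
      (if 1 \<le> n then int (num_partitions (pm_residues (int ` {1, 2, 3, 7, 11, 15, 18, 19, 20, 23, 24, 25}) 52) (n - 1)) else 0) +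
      (if n = 0 then 1 else 0)" for n
    by (rule partition_identity [where m = 1]) (simp_all add: cusp_order_def)
  have p2: "int (num_partitions (pm_residues (int ` {2, 3, 4, 5, 9, 11, 12, 14, 15, 17, 21, 23}) 52) n) =
      (if 0 \<le> n then int (num_partitions (pm_residues (int ` {2, 3, 5, 6, 7, 8, 9, 17, 19, 20, 21, 23}) 52) (n - 0)) else 0) +
      (if n = 4 then 1 else 0)" for n
    by (rule partition_identity [where m = 3]) (simp_all add: cusp_order_def)
  have p3: "int (num_partitions (pm_residues (int ` {3, 4, 5, 9, 10, 11, 14, 15, 16, 17, 21, 23}) 52) n) =
      (if 3 \<le> n then int (num_partitions (pm_residues (int ` {1, 5, 6, 9, 11, 14, 15, 17, 20, 21, 24, 25}) 52) (n - 3)) else 0) +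
      (if n = 0 then 1 else 0)" for n
    by (rule partition_identity [where m = 5]) (simp_all add: cusp_order_def)
  have p4: "int (num_partitions (pm_residues (int ` {2, 3, 5, 7, 8, 9, 17, 19, 21, 22, 23, 24}) 52) n) =
      (if 2 \<le> n then int (num_partitions (pm_residues (int ` {1, 3, 5, 7, 12, 14, 16, 19, 21, 22, 23, 25}) 52) (n - 2)) else 0) +
      (if n = 0 then 1 else 0)" for n
    by (rule partition_identity [where m = 7]) (simp_all add: cusp_order_def)
  have p5: "int (num_partitions (pm_residues (int ` {1, 6, 7, 9, 10, 11, 12, 15, 16, 17, 19, 25}) 52) n) =
      (if 1 \<le> n then int (num_partitions (pm_residues (int ` {1, 5, 6, 8, 9, 11, 15, 17, 18, 21, 24, 25}) 52) (n - 1)) else 0) +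
      (if n = 0 then 1 else 0)" for n
    by (rule partition_identity [where m = 9]) (simp_all add: cusp_order_def)
  have p6: "int (num_partitions (pm_residues (int ` {1, 4, 7, 9, 10, 11, 12, 15, 17, 19, 22, 25}) 52) n) =
      (if 1 \<le> n then int (num_partitions (pm_residues (int ` {1, 3, 7, 8, 10, 11, 15, 18, 19, 20, 23, 25}) 52) (n - 1)) else 0) +
      (if n = 0 then 1 else 0)" for n
    by (rule partition_identity [where m = 11]) (simp_all add: cusp_order_def)
  show ?thesis
    unfolding Let_def
  proof (intro conjI allI impI)
    fix n :: nat
    show "num_partitions (pm_residues {1, 3, 4, 5, 7, 16, 18, 19, 21, 22, 23, 25} 52) n = num_partitions (pm_residues {1, 2, 3, 7, 11, 15, 18, 19, 20, 23, 24, 25} 52) (n - 1)"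
      if "n \<ge> 1"
      using p1 [of n] that by simp
    show "num_partitions (pm_residues {2, 3, 4, 5, 9, 11, 12, 14, 15, 17, 21, 23} 52) n = num_partitions (pm_residues {2, 3, 5, 6, 7, 8, 9, 17, 19, 20, 21, 23} 52) n"
      if "n \<noteq> 4"
      using p2 [of n] that by simp
    show "num_partitions (pm_residues {3, 4, 5, 9, 10, 11, 14, 15, 16, 17, 21, 23} 52) n = num_partitions (pm_residues {1, 5, 6, 9, 11, 14, 15, 17, 20, 21, 24, 25} 52) (n - 3)"
      if "n \<ge> 3"
      using p3 [of n] that by simp
    show "num_partitions (pm_residues {2, 3, 5, 7, 8, 9, 17, 19, 21, 22, 23, 24} 52) n = num_partitions (pm_residues {1, 3, 5, 7, 12, 14, 16, 19, 21, 22, 23, 25} 52) (n - 2)"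
      if "n \<ge> 2"
      using p4 [of n] that by simp
    show "num_partitions (pm_residues {1, 6, 7, 9, 10, 11, 12, 15, 16, 17, 19, 25} 52) n = num_partitions (pm_residues {1, 5, 6, 8, 9, 11, 15, 17, 18, 21, 24, 25} 52) (n - 1)"
      if "n \<ge> 1"
      using p5 [of n] that by simp
    show "num_partitions (pm_residues {1, 4, 7, 9, 10, 11, 12, 15, 17, 19, 22, 25} 52) n = num_partitions (pm_residues {1, 3, 7, 8, 10, 11, 15, 18, 19, 20, 23, 25} 52) (n - 1)"
      if "n \<ge> 1"
      using p6 [of n] that by simp
  qed
qed

end
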